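(* Consider the X-REGO algorithm (described in the context) with $0<\lambda<\epsilon$. Suppose that: (1) $f:\mathcal{X}\to\mathbb{R}$ is Lipschitz continuous with constant $L>0$: $|f(x)-f(y)|\le L\|x-y\|_2$ for all $x,y\in\mathcal{X}$; (2) there is $\rho_{lb}>0$ such that for all $k\ge1$ there exists $\rho^k\in[\rho_{lb},1]$ with $\mathbb{P}[S^k=1\mid\mathcal{F}^{k-1/2}]\ge\rho^k$; (3) there exists a global minimizer $x^*$ of $f$ over $\mathcal{X}$ such that $B_{(\epsilon-\lambda)/L}(x^* )\subset\mathcal{X}$; (4) $\|p^k-x^*\|\le R_{\max}$ for all $k\ge0$ (for all realizations), for some constant $R_{\max}>(\epsilon-\lambda)/L$; (5) $d^k\ge d_{lb}$ for all $k\ge1$, for some integer $1\le d_{lb}<D$. Then $x^k_{opt}$ converges to the set of $\epsilon$-minimizers $G_\epsilon$ almost surely as $k\to\infty$, and for any $\xi\in(0,1)$, $$\mathbb{P}[x^k_{opt}\in G_\epsilon]=\mathbb{P}[f(x^k_{opt})\le f^*+\epsilon]\ge\xi\quad\text{for all } k\ge K_\xi,$$ for some $K_\xi$ satisfying $$K_\xi=\frac{|\log(1-\xi)|}{\rho_{lb}}\,O\left(D^{\frac{2-d_{lb}}{2}}\left(\frac{LR_{\max}}{\epsilon-\lambda}\right)^{D-d_{lb}}\right)\quad\text{as } D\to\infty .$$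
   Context: Problem: $f^*:=\min_{x\in\mathcal{X}}f(x)$ (attained), where $\mathcal{X}\subseteq\mathbb{R}^D$ has non-empty interior (possibly unbounded). $G_\epsilon:=\{x\in\mathcal{X}: f(x)\le f^*+\epsilon\}$; $B_r(x)$ is the closed Euclidean ball of radius $r$ centred at $x$. X-REGO as a stochastic process: $p^0$ is a random vector with values in $\mathcal{X}$. For $k\ge1$: a deterministic dimension $d^k\in\{1,\dots,D-1\}$ is given; $A^k$ is a $D\times d^k$ Gaussian matrix (independent standard normal entries), drawn independently of the past $\mathcal{F}^{k-1}$; the random reduced problem is $$(\mathrm{RP}\mathcal{X}^k)\qquad f^k_{min}=\min_{y\in\mathbb{R}^{d^k}} f(A^ky+p^{k-1})\ \text{ subject to } A^ky+p^{k-1}\in\mathcal{X};$$ a (deterministic or stochastic) solver returns a random vector $y^k\in\mathbb{R}^{d^k}$ feasible for it; one sets $x^k:=A^ky^k+p^{k-1}\in\mathcal{X}$; and a random vector $p^k$ with values in $\mathcal{X}$ is chosen (deterministically or randomly, possibly depending on the past). $x^k_{opt}:=\arg\min\{f(x^1),\dots,f(x^k)\}$, i.e. a point among $x^1,\dots,x^k$ with smallest value of $f$. $S^k:=\mathbf{1}\{f(A^ky^k+p^{k-1})\le f^k_{min}+\lambda\}$ (the $k$th reduced problem is solved to accuracy $\lambda$). $\mathcal{F}^0=\sigma(p^0)$, $\mathcal{F}^k=\sigma(A^1,\dots,A^k,y^1,\dots,y^k,p^0,\dots,p^k)$, $\mathcal{F}^{k-1/2}=\sigma(A^1,\dots,A^k,y^1,\dots,y^{k-1},p^0,\dots,p^{k-1})$;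 $S^k$ is $\mathcal{F}^k$-measurable. "$x^k_{opt}$ converges to $G_\epsilon$ almost surely" means that with probability one $x^k_{opt}\in G_\epsilon$ for all sufficiently large $k$, equivalently $\lim_{k\to\infty}\mathbb{P}[x^k_{opt}\in G_\epsilon]=1$. The asymptotic statement concerns a family of such problems indexed by $D$, with $L,\epsilon,\lambda,d_{lb},\xi$ fixed and $R_{\max}$ either fixed or tending to infinity with $D$; the constant in $O(\cdot)$ is independent of $D$. *)

theory Defs
  imports "HOL-Probability.Probability"
begin

text \<open>
  The ambient dimension has to be a variable of the logic, because the asymptotic claim lets it
  tend to infinity. Vectors of dimension \<open>n\<close> are therefore the extensional functions on
  \<open>{..<n}\<close>, i.e. the points of the product space below, and matrices are the extensional functions
  on \<open>{..<m} \<times> {..<n}\<close>.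
\<close>

abbreviation RV :: "nat \<Rightarrow> (nat \<Rightarrow> real) measure" where
  "RV n \<equiv> \<Pi>\<^sub>M i\<in>{..<n}. borel"

abbreviation RM :: "nat \<Rightarrow> nat \<Rightarrow> (nat \<times> nat \<Rightarrow> real) measure" where
  "RM m n \<equiv> \<Pi>\<^sub>M ij\<in>{..<m} \<times> {..<n}. borel"

definition euclid_dist :: "nat \<Rightarrow> (nat \<Rightarrow> real) \<Rightarrow> (nat \<Rightarrow> real) \<Rightarrow> real" where
  "euclid_dist D x z = L2_set (\<lambda>i. x i - z i) {..<D}"

definition euclid_cball :: "nat \<Rightarrow> (nat \<Rightarrow> real) \<Rightarrow> real \<Rightarrow> (nat \<Rightarrow> real) set" where
  "euclid_cball D x r = {z \<in> space (RV D). euclid_dist D x z \<le> r}"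

definition affine_emb ::
    "nat \<Rightarrow> nat \<Rightarrow> (nat \<times> nat \<Rightarrow> real) \<Rightarrow> (nat \<Rightarrow> real) \<Rightarrow> (nat \<Rightarrow> real) \<Rightarrow> (nat \<Rightarrow> real)" where
  "affine_emb D d A y p = (\<lambda>i\<in>{..<D}. (\<Sum>j<d. A (i, j) * y j) + p i)"

definition fstar :: "(nat \<Rightarrow> real) set \<Rightarrow> ((nat \<Rightarrow> real) \<Rightarrow> real) \<Rightarrow> real" where
  "fstar X f = (INF x\<in>X. f x)"

definition eps_min :: "(nat \<Rightarrow> real) set \<Rightarrow> ((nat \<Rightarrow> real) \<Rightarrow> real) \<Rightarrow> real \<Rightarrow> (nat \<Rightarrow> real) set" where
  "eps_min X f \<epsilon> = {x \<in> X. f x \<le> fstar X f + \<epsilon>}"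

text \<open>
  The optimal value of the reduced problem is an infimum: it agrees with the minimum whenever the
  latter is attained, which is not guaranteed here since \<open>X\<close> need be neither closed nor bounded.
\<close>

definition reduced_min ::
    "nat \<Rightarrow> (nat \<Rightarrow> real) set \<Rightarrow> ((nat \<Rightarrow> real) \<Rightarrow> real) \<Rightarrow> nat \<Rightarrow>
     (nat \<times> nat \<Rightarrow> real) \<Rightarrow> (nat \<Rightarrow> real) \<Rightarrow> real" where
  "reduced_min D X f d A p =
     (INF y\<in>{y \<in> space (RV d). affine_emb D d A y p \<in> X}. f (affine_emb D d A y p))"

definition iterate ::
    "nat \<Rightarrow> (nat \<Rightarrow> nat) \<Rightarrow> (nat \<Rightarrow> 'w \<Rightarrow> nat \<times> nat \<Rightarrow> real) \<Rightarrow> (nat \<Rightarrow> 'w \<Rightarrow> nat \<Rightarrow> real) \<Rightarrow>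
     (nat \<Rightarrow> 'w \<Rightarrow> nat \<Rightarrow> real) \<Rightarrow> nat \<Rightarrow> 'w \<Rightarrow> (nat \<Rightarrow> real)" where
  "iterate D d A y p k \<omega> = affine_emb D (d k) (A k \<omega>) (y k \<omega>) (p (k - 1) \<omega>)"

text \<open>The event \<open>S\<^sup>k = 1\<close>.\<close>

definition solved ::
    "'w measure \<Rightarrow> nat \<Rightarrow> (nat \<Rightarrow> real) set \<Rightarrow> ((nat \<Rightarrow> real) \<Rightarrow> real) \<Rightarrow> real \<Rightarrow> (nat \<Rightarrow> nat) \<Rightarrow>
     (nat \<Rightarrow> 'w \<Rightarrow> nat \<times> nat \<Rightarrow> real) \<Rightarrow> (nat \<Rightarrow> 'w \<Rightarrow> nat \<Rightarrow> real) \<Rightarrow>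
     (nat \<Rightarrow> 'w \<Rightarrow> nat \<Rightarrow> real) \<Rightarrow> nat \<Rightarrow> 'w set" where
  "solved M D X f lam d A y p k =
     {\<omega> \<in> space M. f (iterate D d A y p k \<omega>)
        \<le> reduced_min D X f (d k) (A k \<omega>) (p (k - 1) \<omega>) + lam}"

text \<open>
  \<open>hist M D d A y p a b c\<close> is the sigma-algebra generated by
  \<open>A\<^sup>1, \<dots>, A\<^sup>a, y\<^sup>1, \<dots>, y\<^sup>b, p\<^sup>0, \<dots>, p\<^sup>c\<close>.
\<close>

definition hist ::
    "'w measure \<Rightarrow> nat \<Rightarrow> (nat \<Rightarrow> nat) \<Rightarrow> (nat \<Rightarrow> 'w \<Rightarrow> nat \<times> nat \<Rightarrow> real) \<Rightarrow>
     (nat \<Rightarrow> 'w \<Rightarrow> nat \<Rightarrow> real) \<Rightarrow> (nat \<Rightarrow> 'w \<Rightarrow> nat \<Rightarrow> real) \<Rightarrow> nat \<Rightarrow> nat \<Rightarrow> nat \<Rightarrow> 'w measure" where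
  "hist M D d A y p a b c = sigma (space M)
     ((\<Union>i\<in>{1..a}. sets (vimage_algebra (space M) (A i) (RM D (d i)))) \<union>
      (\<Union>i\<in>{1..b}. sets (vimage_algebra (space M) (y i) (RV (d i)))) \<union>
      (\<Union>i\<in>{0..c}. sets (vimage_algebra (space M) (p i) (RV D))))"

definition F_full ::
    "'w measure \<Rightarrow> nat \<Rightarrow> (nat \<Rightarrow> nat) \<Rightarrow> (nat \<Rightarrow> 'w \<Rightarrow> nat \<times> nat \<Rightarrow> real) \<Rightarrow>
     (nat \<Rightarrow> 'w \<Rightarrow> nat \<Rightarrow> real) \<Rightarrow> (nat \<Rightarrow> 'w \<Rightarrow> nat \<Rightarrow> real) \<Rightarrow> nat \<Rightarrow> 'w measure" where
  "F_full M D d A y p k = hist M D d A y p k k k"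

text \<open>\<open>\<F>\<^sup>k\<^sup>-\<^sup>1\<^sup>/\<^sup>2\<close>, for \<open>k \<ge> 1\<close>.\<close>

definition F_half ::
    "'w measure \<Rightarrow> nat \<Rightarrow> (nat \<Rightarrow> nat) \<Rightarrow> (nat \<Rightarrow> 'w \<Rightarrow> nat \<times> nat \<Rightarrow> real) \<Rightarrow>
     (nat \<Rightarrow> 'w \<Rightarrow> nat \<Rightarrow> real) \<Rightarrow> (nat \<Rightarrow> 'w \<Rightarrow> nat \<Rightarrow> real) \<Rightarrow> nat \<Rightarrow> 'w measure" where
  "F_half M D d A y p k = hist M D d A y p k (k - 1) (k - 1)"

text \<open>
  The index \<open>k\<close> of \<open>d\<close>, \<open>A\<close>, \<open>y\<close> and \<open>xopt\<close> is meaningful for \<open>k \<ge> 1\<close> only, that of \<open>p\<close> for all \<open>k\<close>.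
\<close>

locale xrego = prob_space M for M :: "'w measure" +
  fixes D :: nat
    and X :: "(nat \<Rightarrow> real) set"
    and f :: "(nat \<Rightarrow> real) \<Rightarrow> real"
    and lam :: real
    and d :: "nat \<Rightarrow> nat"
    and A :: "nat \<Rightarrow> 'w \<Rightarrow> nat \<times> nat \<Rightarrow> real"
    and y p xopt :: "nat \<Rightarrow> 'w \<Rightarrow> nat \<Rightarrow> real"
  assumes X_subset: "X \<subseteq> space (RV D)"
    and X_interior: "\<exists>z\<in>space (RV D). \<exists>r>0. euclid_cball D z r \<subseteq> X"
    and d_range: "\<And>k. k \<ge> 1 \<Longrightarrow> d k \<in> {1..D - 1}"
    and p_measurable: "\<And>k. p k \<in> measurable M (RV D)"
    and p_in_X: "\<And>k \<omega>. \<omega> \<in> space M \<Longrightarrow> p k \<omega> \<in> X"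
    and A_measurable: "\<And>k. k \<ge> 1 \<Longrightarrow> A k \<in> measurable M (RM D (d k))"
    and A_normal: "\<And>k i j. \<lbrakk>k \<ge> 1; i < D; j < d k\<rbrakk> \<Longrightarrow>
          distributed M lborel (\<lambda>\<omega>. A k \<omega> (i, j)) (\<lambda>t. ennreal (std_normal_density t))"
    and A_entries_indep: "\<And>k. k \<ge> 1 \<Longrightarrow>
          indep_vars (\<lambda>_. borel) (\<lambda>ij \<omega>. A k \<omega> ij) ({..<D} \<times> {..<d k})"
    and A_indep_past: "\<And>k. k \<ge> 1 \<Longrightarrow>
          indep_set (sets (vimage_algebra (space M) (A k) (RM D (d k))))
                    (sets (F_full M D d A y p (k - 1)))"
    and y_measurable: "\<And>k. k \<ge> 1 \<Longrightarrow> y k \<in> measurable M (RV (d k))"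
    and y_feasible: "\<And>k \<omega>. \<lbrakk>k \<ge> 1; \<omega> \<in> space M\<rbrakk> \<Longrightarrow> iterate D d A y p k \<omega> \<in> X"
    and solved_measurable: "\<And>k. k \<ge> 1 \<Longrightarrow>
          solved M D X f lam d A y p k \<in> sets (F_full M D d A y p k)"
    and xopt_arg_min: "\<And>k \<omega>. \<lbrakk>k \<ge> 1; \<omega> \<in> space M\<rbrakk> \<Longrightarrow>
          is_arg_min f (\<lambda>z. z \<in> (\<lambda>i. iterate D d A y p i \<omega>) ` {1..k}) (xopt k \<omega>)"

end

theory Submission
  imports Defs "HOL-Real_Asymp.Real_Asymp"
begin

text \<open>
  The iterates succeed in step \<open>k\<close> if the random affine subspace through \<open>p\<^sup>k\<^sup>-\<^sup>1\<close> meets the ball of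
  radius \<open>r = (\<epsilon> - \<lambda>) / L\<close> around the minimizer and the reduced problem is solved to accuracy \<open>\<lambda>\<close>.
  Conditionally on the past the first event has probability at least some \<open>\<tau>\<close>, hence \<open>k\<close> steps fail
  with probability at most \<open>(1 - \<rho> \<tau>)^k\<close>; everything reduces to a lower bound on \<open>\<tau>\<close>.

  Only the first \<open>d\<close> (the lower bound on the dimensions) columns of the matrix are used. The probability
  that their span comes within distance \<open>s |v|\<close> of \<open>v\<close>, where \<open>s = r / R\<close>, does not depend on the
  direction of \<open>v\<close>, since Gaussian measure is invariant under Givens rotations. So one may average over a
  Gaussian \<open>v\<close> and exchange the roles: for a fixed matrix of full rank the span can be rotated onto a
  coordinate subspace, and the probability becomes the Gaussian measure of the cone
  \<open>v\<^sub>d\<^sup>2 + \<dots> + v\<^sub>D\<^sub>-\<^sub>1\<^sup>2 < s\<^sup>2 |v|\<^sup>2\<close>. To have full rank with a probability independent of \<open>D\<close>, only matrices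
  whose top block is close to the identity are kept. The Gaussian measure of a cone is the fraction of
  a ball that it occupies; the cone contains a spherical shell in the first \<open>d\<close> coordinates
  times a ball in the others, which gives a bound in terms of volumes of unit balls.
\<close>

section \<open>Givens rotations and Gaussian measure\<close>

text \<open>The index set is arbitrary so that the same measure serves vectors, indexed by
  \<open>{..<D}\<close>, and matrices, indexed by \<open>{..<D} \<times> {..<d}\<close>.\<close>

definition gauss :: "'i set \<Rightarrow> ('i \<Rightarrow> real) measure" where
  "gauss I = (\<Pi>\<^sub>M i\<in>I. density lborel (\<lambda>t. ennreal (std_normal_density t)))"

text \<open>Building block for rotations: three shears compose to a Givens rotation, and each is a
  translation in one coordinate when the others are frozen.\<close>

definition shear :: "'i \<Rightarrow> 'i \<Rightarrow> real \<Rightarrow> ('i \<Rightarrow> real) \<Rightarrow> 'i \<Rightarrow> real" where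
  "shear a b t x = x(a := x a + t * x b)"

definition givens :: "'i \<Rightarrow> 'i \<Rightarrow> real \<Rightarrow> real \<Rightarrow> ('i \<Rightarrow> real) \<Rightarrow> 'i \<Rightarrow> real" where
  "givens a b c s x = x(a := c * x a - s * x b, b := s * x a + c * x b)"

interpretation lborel_prod: product_sigma_finite "\<lambda>_::'i. lborel :: real measure"
  by standard

interpretation normal_prod: product_prob_space
  "\<lambda>_::'i. density lborel (\<lambda>t. ennreal (std_normal_density t))" I for I
  by (intro product_prob_spaceI prob_space_normal_density) simp

lemma sets_gauss [measurable_cong, simp]: "sets (gauss I) = sets (\<Pi>\<^sub>M i\<in>I. borel)"
  unfolding gauss_def by (intro sets_PiM_cong) simp_all

lemma space_gauss [simp]: "space (gauss I) = PiE I (\<lambda>_. UNIV)"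
  by (simp add: gauss_def space_PiM)

lemma prob_space_gauss: "prob_space (gauss I)"
  unfolding gauss_def by (intro prob_space_PiM prob_space_normal_density) simp

lemma measurable_fun_upd_PiM [measurable]:
  assumes "a \<in> I" "f \<in> measurable N (\<Pi>\<^sub>M i\<in>I. borel)" "g \<in> borel_measurable N"
  shows "(\<lambda>x. (f x)(a := g x)) \<in> measurable N (\<Pi>\<^sub>M i\<in>I. (borel :: real measure))"
  using assms by (intro measurable_fun_upd[where J = I]) auto

lemma shear_measurable [measurable]:
  assumes "a \<in> I" "b \<in> I"
  shows "shear a b t \<in> measurable (\<Pi>\<^sub>M i\<in>I. borel) (\<Pi>\<^sub>M i\<in>I. borel)"
  unfolding shear_def
  using assms by (intro measurable_fun_upd_PiM) measurable

lemma givens_measurable [measurable]: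
  assumes "a \<in> I" "b \<in> I"
  shows "givens a b c s \<in> measurable (\<Pi>\<^sub>M i\<in>I. borel) (\<Pi>\<^sub>M i\<in>I. borel)"
  unfolding givens_def
  using assms by (intro measurable_fun_upd_PiM) measurable

lemma measurable_PiM_lborel [simp]:
  "borel_measurable (\<Pi>\<^sub>M i\<in>I. lborel) = borel_measurable (\<Pi>\<^sub>M i\<in>I. (borel :: real measure))"
  "measurable (\<Pi>\<^sub>M i\<in>I. lborel) N = measurable (\<Pi>\<^sub>M i\<in>I. (borel :: real measure)) N"
  by (intro measurable_cong_sets sets_PiM_cong; simp)+

lemma sets_PiM_lborel [measurable_cong]:
  "sets (\<Pi>\<^sub>M i\<in>I. lborel) = sets (\<Pi>\<^sub>M i\<in>I. (borel :: real measure))"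
  by (intro sets_PiM_cong) simp_all

text \<open>Integrate out coordinate \<open>a\<close> first. With the remaining coordinates fixed,
  the shear translates it by the constant \<open>t * x b\<close>, because
  \<open>b \<noteq> a\<close>, and Lebesgue measure is translation invariant.\<close>

lemma nn_integral_shear:
  fixes h :: "('i \<Rightarrow> real) \<Rightarrow> ennreal"
  assumes "finite I" "a \<in> I" "b \<in> I" "a \<noteq> b"
    and h [measurable]: "h \<in> borel_measurable (\<Pi>\<^sub>M i\<in>I. borel)"
  shows "(\<integral>\<^sup>+x. h (shear a b t x) \<partial>(\<Pi>\<^sub>M i\<in>I. lborel)) = (\<integral>\<^sup>+x. h x \<partial>(\<Pi>\<^sub>M i\<in>I. lborel))"
proof -
  define J where "J = I - {a}"
  have I: "I = insert a J" "finite J" "a \<notin> J" "b \<in> J"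
    using assms by (auto simp: J_def)
  have aI: "a \<in> I" and bI: "b \<in> I" by fact+
  have m: "(\<lambda>x. h (shear a b t x)) \<in> borel_measurable (\<Pi>\<^sub>M i\<in>I. borel)"
    using aI bI by measurable
  have "(\<integral>\<^sup>+x. h (shear a b t x) \<partial>(\<Pi>\<^sub>M i\<in>I. lborel)) =
      (\<integral>\<^sup>+x. \<integral>\<^sup>+u. h (shear a b t (x(a := u))) \<partial>lborel \<partial>(\<Pi>\<^sub>M i\<in>J. lborel))"
    unfolding I(1) using I m by (intro lborel_prod.product_nn_integral_insert) auto
  also have "\<dots> = (\<integral>\<^sup>+x. \<integral>\<^sup>+u. h (x(a := u)) \<partial>lborel \<partial>(\<Pi>\<^sub>M i\<in>J. lborel))"
  proof (rule nn_integral_cong)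
    fix x :: "'i \<Rightarrow> real" assume "x \<in> space (\<Pi>\<^sub>M i\<in>J. lborel)"
    then have x: "x \<in> space (\<Pi>\<^sub>M i\<in>J. borel)" by (simp add: space_PiM)
    have "(\<lambda>u. x(a := u)) \<in> borel \<rightarrow>\<^sub>M (\<Pi>\<^sub>M i\<in>I. borel)"
      unfolding I(1) using x by (intro measurable_fun_upd[where J = J]) auto
    from measurable_compose[OF this h]
    have [measurable]: "(\<lambda>u. h (x(a := u))) \<in> borel_measurable borel" .
    have "(\<integral>\<^sup>+u. h (shear a b t (x(a := u))) \<partial>lborel) = (\<integral>\<^sup>+u. h (x(a := t * x b + 1 * u)) \<partial>lborel)"
      using assms by (intro nn_integral_cong) (auto simp: shear_def algebra_simps)
    also have "\<dots> = (\<integral>\<^sup>+u. h (x(a := u)) \<partial>lborel)"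
      by (subst nn_integral_real_affine[where c = 1 and t = "t * x b" and f = "\<lambda>u. h (x(a := u))"]) simp_all
    finally show "(\<integral>\<^sup>+u. h (shear a b t (x(a := u))) \<partial>lborel) = (\<integral>\<^sup>+u. h (x(a := u)) \<partial>lborel)" .
  qed
  also have "\<dots> = (\<integral>\<^sup>+x. h x \<partial>(\<Pi>\<^sub>M i\<in>I. lborel))"
    unfolding I(1) using I h by (intro lborel_prod.product_nn_integral_insert[symmetric]) auto
  finally show ?thesis .
qed

text \<open>Lifting scheme: with \<open>c\<close> and \<open>s\<close> the cosine and sine of an
  angle, \<open>s / (1 + c)\<close> is the tangent of half the angle. It is undefined only for the
  half turn \<open>c = -1\<close>, which is therefore excluded throughout.\<close>

lemma givens_eq_shears:
  assumes "a \<noteq> b" "c\<^sup>2 + s\<^sup>2 = 1" "c \<noteq> -1"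
  shows "givens a b c s x = shear a b (- s / (1 + c)) (shear b a s (shear a b (- s / (1 + c)) x))"
proof -
  define t where "t = s / (1 + c)"
  have nz: "1 + c \<noteq> 0" using assms(3) by linarith
  have 1: "t * (1 + c) = s" using nz by (simp add: t_def)
  have "s\<^sup>2 = (1 - c) * (1 + c)" using assms(2) by (simp add: power2_eq_square algebra_simps)
  then have 2: "s * t = 1 - c" using nz by (simp add: t_def power2_eq_square)
  have 3: "- s / (1 + c) = - t" by (simp add: t_def)
  have 4: "x b + s * (x a + - t * x b) = s * x a + c * x b"
    using 2 by (simp add: algebra_simps) (metis (no_types) mult.commute mult.left_commute add.commute diff_add_cancel distrib_left mult.right_neutral)
  have "x a - t * x b - t * (s * x a + c * x b) = x a - (s * t) * x a - (t * (1 + c)) * x b"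
    by (simp add: algebra_simps)
  then have 5: "x a + - t * x b + - t * (s * x a + c * x b) = c * x a - s * x b"
    unfolding 1 2 by (simp add: algebra_simps)
  show ?thesis
    unfolding 3 givens_def shear_def using assms(1) 4 5 by (auto simp: fun_eq_iff)
qed

lemma sum_squares_givens:
  assumes "finite I" "a \<in> I" "b \<in> I" "a \<noteq> b" "c\<^sup>2 + s\<^sup>2 = 1"
  shows "(\<Sum>i\<in>I. (givens a b c s x i)\<^sup>2) = (\<Sum>i\<in>I. (x i)\<^sup>2)"
proof -
  define J where "J = I - {a, b}"
  have I: "I = insert a (insert b J)" "finite J" "a \<notin> J" "b \<notin> J" using assms by (auto simp: J_def)
  have "(c * x a - s * x b)\<^sup>2 + (s * x a + c * x b)\<^sup>2 = (c\<^sup>2 + s\<^sup>2) * ((x a)\<^sup>2 + (x b)\<^sup>2)"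
    by (simp add: power2_eq_square algebra_simps)
  moreover have "(\<Sum>i\<in>J. (givens a b c s x i)\<^sup>2) = (\<Sum>i\<in>J. (x i)\<^sup>2)"
    using I by (intro sum.cong) (auto simp: givens_def)
  ultimately show ?thesis
    unfolding I(1) using I(2-4) assms(4,5) by (simp add: givens_def)
qed

text \<open>The joint density is written through the sum of squares and not as a product, so that
  its invariance under rotations is visible.\<close>

definition gauss_density :: "'i set \<Rightarrow> ('i \<Rightarrow> real) \<Rightarrow> real" where
  "gauss_density I x = (1 / sqrt (2 * pi)) ^ card I * exp (- (\<Sum>i\<in>I. (x i)\<^sup>2) / 2)"

lemma gauss_density_nonneg [simp]: "gauss_density I x \<ge> 0"
  by (simp add: gauss_density_def)

lemma gauss_density_measurable [measurable]:
  "gauss_density I \<in> borel_measurable (\<Pi>\<^sub>M i\<in>I. borel)"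
  unfolding gauss_density_def[abs_def] by measurable

lemma gauss_density_prod:
  assumes "finite I"
  shows "ennreal (gauss_density I x) = (\<Prod>i\<in>I. ennreal (std_normal_density (x i)))"
proof -
  have "gauss_density I x = (\<Prod>i\<in>I. std_normal_density (x i))"
    unfolding gauss_density_def std_normal_density_def prod.distrib prod_constant
      exp_sum[OF assms, symmetric] sum_divide_distrib[symmetric] sum_negf by (rule refl)
  then show ?thesis by (simp add: prod_ennreal)
qed

text \<open>A product measure is determined by its values on boxes; on a box both the density and
  the indicator factor over the coordinates, so the integral does too.\<close>

lemma gauss_eq_density:
  assumes "finite I"
  shows "gauss I = density (\<Pi>\<^sub>M i\<in>I. lborel) (\<lambda>x. ennreal (gauss_density I x))"
  unfolding gauss_def
proof (rule normal_prod.PiM_eqI[symmetric])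
  show "sets (density (\<Pi>\<^sub>M i\<in>I. lborel) (\<lambda>x. ennreal (gauss_density I x))) =
      sets (\<Pi>\<^sub>M i\<in>I. density lborel (\<lambda>t. ennreal (std_normal_density t)))"
    by (simp cong: sets_PiM_cong)
  fix A :: "'a \<Rightarrow> real set"
  assume A: "\<And>i. i \<in> I \<Longrightarrow> A i \<in> sets (density lborel (\<lambda>t. ennreal (std_normal_density t)))"
  then have A': "\<And>i. i \<in> I \<Longrightarrow> A i \<in> sets borel" by simp
  have PA: "PiE I A \<in> sets (\<Pi>\<^sub>M i\<in>I. lborel)"
    using A' assms by (intro sets_PiM_I_finite) auto
  have "emeasure (density (\<Pi>\<^sub>M i\<in>I. lborel) (\<lambda>x. ennreal (gauss_density I x))) (PiE I A) =
      (\<integral>\<^sup>+x. ennreal (gauss_density I x) * indicator (PiE I A) x \<partial>(\<Pi>\<^sub>M i\<in>I. lborel))"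
    using PA by (intro emeasure_density) simp_all
  also have "\<dots> = (\<integral>\<^sup>+x. (\<Prod>i\<in>I. ennreal (std_normal_density (x i)) * indicator (A i) (x i)) \<partial>(\<Pi>\<^sub>M i\<in>I. lborel))"
  proof (intro nn_integral_cong)
    fix x :: "'a \<Rightarrow> real" assume x: "x \<in> space (\<Pi>\<^sub>M i\<in>I. lborel)"
    have "indicator (PiE I A) x = (\<Prod>i\<in>I. indicator (A i) (x i) :: ennreal)"
    proof (cases "x \<in> PiE I A")
      case True then show ?thesis by (auto simp: PiE_iff)
    next
      case False
      then obtain i where "i \<in> I" "x i \<notin> A i" using x by (auto simp: PiE_iff space_PiM)
      then have "(\<Prod>i\<in>I. indicator (A i) (x i) :: ennreal) = 0"
        using assms by (intro prod_zero bexI[of _ i]) auto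
      then show ?thesis using False by simp
    qed
    then show "ennreal (gauss_density I x) * indicator (PiE I A) x =
        (\<Prod>i\<in>I. ennreal (std_normal_density (x i)) * indicator (A i) (x i))"
      by (simp add: gauss_density_prod[OF assms] prod.distrib)
  qed
  also have "\<dots> = (\<Prod>i\<in>I. \<integral>\<^sup>+t. ennreal (std_normal_density t) * indicator (A i) t \<partial>lborel)"
    using assms A' by (intro lborel_prod.product_nn_integral_prod) auto
  also have "\<dots> = (\<Prod>i\<in>I. emeasure (density lborel (\<lambda>t. ennreal (std_normal_density t))) (A i))"
    using A' by (intro prod.cong refl emeasure_density[symmetric]) auto
  finally show "emeasure (density (\<Pi>\<^sub>M i\<in>I. lborel) (\<lambda>x. ennreal (gauss_density I x))) (PiE I A) =
      (\<Prod>i\<in>I. emeasure (density lborel (\<lambda>t. ennreal (std_normal_density t))) (A i))" .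
qed fact

lemma nn_integral_gauss:
  assumes "finite I" "h \<in> borel_measurable (\<Pi>\<^sub>M i\<in>I. borel)"
  shows "(\<integral>\<^sup>+x. h x \<partial>gauss I) = (\<integral>\<^sup>+x. ennreal (gauss_density I x) * h x \<partial>(\<Pi>\<^sub>M i\<in>I. lborel))"
  unfolding gauss_eq_density[OF assms(1)]
  using assms(2) by (intro nn_integral_density) simp_all

text \<open>The density sees only the norm, so it may be evaluated at the rotated point. The
  integrand is then a function of three composed shears, which are peeled off one at a time.\<close>

lemma nn_integral_gauss_givens:
  fixes h :: "('i \<Rightarrow> real) \<Rightarrow> ennreal"
  assumes I: "finite I" "a \<in> I" "b \<in> I" "a \<noteq> b" and cs: "c\<^sup>2 + s\<^sup>2 = 1" "c \<noteq> -1"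
    and h [measurable]: "h \<in> borel_measurable (\<Pi>\<^sub>M i\<in>I. borel)"
  shows "(\<integral>\<^sup>+x. h (givens a b c s x) \<partial>gauss I) = (\<integral>\<^sup>+x. h x \<partial>gauss I)"
proof -
  note [measurable] = I(2,3)
  let ?k = "\<lambda>x. ennreal (gauss_density I x) * h x"
  let ?t = "- s / (1 + c)"
  have k [measurable]: "?k \<in> borel_measurable (\<Pi>\<^sub>M i\<in>I. borel)" by measurable
  have "(\<integral>\<^sup>+x. h (givens a b c s x) \<partial>gauss I) =
      (\<integral>\<^sup>+x. ?k (givens a b c s x) \<partial>(\<Pi>\<^sub>M i\<in>I. lborel))"
    using I cs by (subst nn_integral_gauss) (simp_all add: gauss_density_def sum_squares_givens)
  also have "\<dots> = (\<integral>\<^sup>+x. ?k (shear a b ?t (shear b a s (shear a b ?t x))) \<partial>(\<Pi>\<^sub>M i\<in>I. lborel))"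
    using I cs by (simp add: givens_eq_shears)
  also have "\<dots> = (\<integral>\<^sup>+x. ?k (shear a b ?t (shear b a s x)) \<partial>(\<Pi>\<^sub>M i\<in>I. lborel))"
    using I by (intro nn_integral_shear[where h = "\<lambda>x. ?k (shear a b ?t (shear b a s x))"]) auto
  also have "\<dots> = (\<integral>\<^sup>+x. ?k (shear a b ?t x) \<partial>(\<Pi>\<^sub>M i\<in>I. lborel))"
    using I by (intro nn_integral_shear[where h = "\<lambda>x. ?k (shear a b ?t x)"]) auto
  also have "\<dots> = (\<integral>\<^sup>+x. ?k x \<partial>(\<Pi>\<^sub>M i\<in>I. lborel))"
    using I by (intro nn_integral_shear k) auto
  also have "\<dots> = (\<integral>\<^sup>+x. h x \<partial>gauss I)"
    using I by (simp add: nn_integral_gauss)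
  finally show ?thesis .
qed

lemma distr_gauss_givens:
  assumes I: "finite I" "a \<in> I" "b \<in> I" "a \<noteq> b" and cs: "c\<^sup>2 + s\<^sup>2 = 1" "c \<noteq> -1"
  shows "distr (gauss I) (gauss I) (givens a b c s) = gauss I"
proof (rule measure_eqI)
  note [measurable] = I(2,3)
  fix A assume "A \<in> sets (distr (gauss I) (gauss I) (givens a b c s))"
  then have [measurable]: "A \<in> sets (\<Pi>\<^sub>M i\<in>I. borel)" by simp
  have "emeasure (distr (gauss I) (gauss I) (givens a b c s)) A =
      (\<integral>\<^sup>+x. indicator A x \<partial>distr (gauss I) (gauss I) (givens a b c s))"
    by simp
  also have "\<dots> = (\<integral>\<^sup>+x. indicator A (givens a b c s x) \<partial>gauss I)"
    by (intro nn_integral_distr) measurable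
  also have "\<dots> = (\<integral>\<^sup>+x. indicator A x \<partial>gauss I)"
    by (intro nn_integral_gauss_givens assms) measurable
  finally show "emeasure (distr (gauss I) (gauss I) (givens a b c s)) A = emeasure (gauss I) A"
    by simp
qed simp

section \<open>Distance of a vector to the column space of a Gaussian matrix\<close>

definition sq_norm :: "nat \<Rightarrow> (nat \<Rightarrow> real) \<Rightarrow> real" where
  "sq_norm D x = (\<Sum>i<D. (x i)\<^sup>2)"

lemma sq_norm_nonneg [simp]: "sq_norm D x \<ge> 0"
  by (simp add: sq_norm_def sum_nonneg)

lemma sq_norm_eq_0_iff: "sq_norm D x = 0 \<longleftrightarrow> (\<forall>i<D. x i = 0)"
  unfolding sq_norm_def by (subst sum_nonneg_eq_0_iff) auto

lemma sq_norm_givens: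
  assumes "a < D" "b < D" "a \<noteq> b" "c\<^sup>2 + s\<^sup>2 = 1"
  shows "sq_norm D (givens a b c s x) = sq_norm D x"
  unfolding sq_norm_def using assms by (intro sum_squares_givens) auto

text \<open>Left multiplication by a rotation, done column by column: each step is a single Givens
  rotation of the entries \<open>(a, m)\<close> and \<open>(b, m)\<close>, so the invariance of
  \<open>gauss\<close> for one rotation carries over by induction.\<close>

fun rows_givens ::
    "nat \<Rightarrow> nat \<Rightarrow> real \<Rightarrow> real \<Rightarrow> nat \<Rightarrow> (nat \<times> nat \<Rightarrow> real) \<Rightarrow> nat \<times> nat \<Rightarrow> real" where
  "rows_givens a b c s 0 A = A"
| "rows_givens a b c s (Suc m) A = givens (a, m) (b, m) c s (rows_givens a b c s m A)"

lemma rows_givens_apply: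
  assumes "a \<noteq> b"
  shows "rows_givens a b c s m A (i, j) =
    (if j < m then givens a b c s (\<lambda>i. A (i, j)) i else A (i, j))"
  using assms by (induction m arbitrary: i j) (auto simp: givens_def less_Suc_eq)

lemma rows_givens_measurable:
  assumes "a < D" "b < D" "m \<le> d"
  shows "rows_givens a b c s m \<in> measurable (RM D d) (RM D d)"
  using assms(3)
proof (induction m)
  case 0 show ?case by simp
next
  case (Suc m)
  have "givens (a, m) (b, m) c s \<in> measurable (RM D d) (RM D d)"
    using Suc.prems assms by (intro givens_measurable) auto
  from measurable_compose[OF Suc.IH this] Suc.prems show ?case by simp
qed

lemma distr_rows_givens:
  assumes "a < D" "b < D" "a \<noteq> b" "c\<^sup>2 + s\<^sup>2 = 1" "c \<noteq> -1" "m \<le> d"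
  shows "distr (gauss ({..<D} \<times> {..<d})) (gauss ({..<D} \<times> {..<d})) (rows_givens a b c s m) =
    gauss ({..<D} \<times> {..<d})" (is "distr ?G ?G _ = ?G")
  using assms(6)
proof (induction m)
  case 0 show ?case by (simp add: distr_id)
next
  case (Suc m)
  have 1: "givens (a, m) (b, m) c s \<in> measurable ?G ?G"
    using Suc.prems assms givens_measurable[of "(a, m)" "{..<D} \<times> {..<d}" "(b, m)" c s]
    by (simp cong: measurable_cong_sets)
  have 2: "rows_givens a b c s m \<in> measurable ?G ?G"
    using Suc.prems assms rows_givens_measurable[of a D b m d c s]
    by (simp cong: measurable_cong_sets)
  have "distr ?G ?G (rows_givens a b c s (Suc m)) =
      distr (distr ?G ?G (rows_givens a b c s m)) ?G (givens (a, m) (b, m) c s)"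
    unfolding distr_distr[OF 1 2] by (simp add: o_def fun_eq_iff cong: distr_cong)
  also have "\<dots> = ?G"
    using Suc assms by (simp add: distr_gauss_givens)
  finally show ?case .
qed

lemma affine_emb_rows_givens:
  assumes "a < D" "b < D" "a \<noteq> b"
  shows "affine_emb D d (rows_givens a b c s d A) y (givens a b c s v) =
    givens a b c s (affine_emb D d A y v)"
proof
  fix i
  consider "i = a" | "i = b" | "i \<noteq> a" "i \<noteq> b" by blast
  then show "affine_emb D d (rows_givens a b c s d A) y (givens a b c s v) i =
      givens a b c s (affine_emb D d A y v) i"
    using assms
    by cases (auto simp: affine_emb_def rows_givens_apply givens_def algebra_simps sum.distrib
        sum_subtractf sum_distrib_left intro!: sum.cong)
qed

lemma sq_norm_affine_emb:
  "sq_norm D (affine_emb D d A y v) = (\<Sum>i<D. ((\<Sum>j<d. A (i, j) * y j) + v i)\<^sup>2)"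
  by (simp add: sq_norm_def affine_emb_def)

lemma sq_norm_affine_emb_rows_givens:
  assumes "a < D" "b < D" "a \<noteq> b" "c\<^sup>2 + s\<^sup>2 = 1"
  shows "sq_norm D (affine_emb D d (rows_givens a b c s d A) y (givens a b c s v)) =
    sq_norm D (affine_emb D d A y v)"
  using assms by (simp add: affine_emb_rows_givens sq_norm_givens)

text \<open>The left-hand side is continuous in the coefficients and the inequality is strict, so it
  survives a small enough rational perturbation.\<close>

lemma rational_coefficients:
  assumes "sq_norm D (affine_emb D d A y v) < t"
  shows "\<exists>z\<in>PiE {..<d} (\<lambda>_. \<rat>). sq_norm D (affine_emb D d A z v) < t"
proof -
  have ex: "\<exists>q. q \<in> \<rat> \<and> \<bar>q - y j\<bar> < 1 / real (Suc n)" for n j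
  proof -
    obtain q where "q \<in> \<rat>" "y j - 1 / real (Suc n) < q" "q < y j + 1 / real (Suc n)"
      using Rats_dense_in_real[of "y j - 1 / real (Suc n)" "y j + 1 / real (Suc n)"] by auto
    then show ?thesis by (intro exI[of _ q]) auto
  qed
  define q where "q n j = (SOME q. q \<in> \<rat> \<and> \<bar>q - y j\<bar> < 1 / real (Suc n))" for n j
  have q: "q n j \<in> \<rat>" "\<bar>q n j - y j\<bar> < 1 / real (Suc n)" for n j
    using someI_ex[OF ex, of j n] unfolding q_def by blast+
  have lim: "(\<lambda>n. q n j) \<longlonglongrightarrow> y j" for j
  proof -
    have "(\<lambda>n. q n j - y j) \<longlonglongrightarrow> 0"
    proof (rule Lim_null_comparison)
      show "\<forall>\<^sub>F n in sequentially. norm (q n j - y j) \<le> 1 / real (Suc n)"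
        using q(2)[of _ j] by (auto intro!: always_eventually less_imp_le)
      show "(\<lambda>n. 1 / real (Suc n)) \<longlonglongrightarrow> 0"
        using LIMSEQ_inverse_real_of_nat by (simp add: inverse_eq_divide)
    qed
    then show ?thesis by (simp add: LIM_zero_iff)
  qed
  have "(\<lambda>n. sq_norm D (affine_emb D d A (q n) v)) \<longlonglongrightarrow> sq_norm D (affine_emb D d A y v)"
    unfolding sq_norm_affine_emb by (intro tendsto_intros lim)
  then have "\<forall>\<^sub>F n in sequentially. sq_norm D (affine_emb D d A (q n) v) < t"
    using assms by (rule order_tendstoD)
  then obtain n where n: "sq_norm D (affine_emb D d A (q n) v) < t"
    by (auto simp: eventually_sequentially)
  \<comment> \<open>Only the first \<open>d\<close> coefficients enter, so the approximation may be
    made extensional.\<close>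
  have "sq_norm D (affine_emb D d A (restrict (q n) {..<d}) v) = sq_norm D (affine_emb D d A (q n) v)"
    unfolding sq_norm_affine_emb by (intro sum.cong) auto
  with n q(1) show ?thesis
    by (intro bexI[of _ "restrict (q n) {..<d}"]) auto
qed

text \<open>Coefficients are restricted to rationals to make membership a countable union of measurable conditions.\<close>

definition col_cone :: "nat \<Rightarrow> nat \<Rightarrow> real \<Rightarrow> (nat \<times> nat \<Rightarrow> real) \<Rightarrow> (nat \<Rightarrow> real) set" where
  "col_cone D d s A = {v \<in> space (RV D).
     \<exists>y\<in>PiE {..<d} (\<lambda>_. \<rat>). sq_norm D (affine_emb D d A y v) < s\<^sup>2 * sq_norm D v}"

lemma mem_col_cone:
  "v \<in> col_cone D d s A \<longleftrightarrow>
     v \<in> space (RV D) \<and> (\<exists>y. sq_norm D (affine_emb D d A y v) < s\<^sup>2 * sq_norm D v)"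
  unfolding col_cone_def using rational_coefficients by blast

lemma givens_space [simp]:
  assumes "a < D" "b < D"
  shows "givens a b c s v \<in> space (RV D) \<longleftrightarrow> v \<in> space (RV D)"
  using assms by (auto simp: space_PiM givens_def PiE_iff extensional_def)

lemma givens_mem_col_cone:
  assumes "a < D" "b < D" "a \<noteq> b" "c\<^sup>2 + s\<^sup>2 = 1"
  shows "givens a b c s v \<in> col_cone D d t (rows_givens a b c s d A) \<longleftrightarrow> v \<in> col_cone D d t A"
  unfolding mem_col_cone using assms
  by (simp add: sq_norm_affine_emb_rows_givens sq_norm_givens)

lemma scale_mem_col_cone:
  assumes "r \<noteq> 0" "v \<in> space (RV D)" "w \<in> space (RV D)" "\<And>i. i < D \<Longrightarrow> w i = r * v i"
  shows "w \<in> col_cone D d s A \<longleftrightarrow> v \<in> col_cone D d s A"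
proof -
  have *: "w \<in> col_cone D d s A"
    if "r \<noteq> 0" "w \<in> space (RV D)" "\<And>i. i < D \<Longrightarrow> w i = r * v i" "v \<in> col_cone D d s A" for r v w
  proof -
    from that obtain y where y: "sq_norm D (affine_emb D d A y v) < s\<^sup>2 * sq_norm D v"
      unfolding mem_col_cone by blast
    have "sq_norm D (affine_emb D d A (\<lambda>j. r * y j) w) = r\<^sup>2 * sq_norm D (affine_emb D d A y v)"
      unfolding sq_norm_affine_emb using that(3)
      by (simp add: sum_distrib_left power_mult_distrib[symmetric] algebra_simps)
    moreover have "sq_norm D w = r\<^sup>2 * sq_norm D v"
      using that(3) by (simp add: sq_norm_def sum_distrib_left power_mult_distrib)
    ultimately have "sq_norm D (affine_emb D d A (\<lambda>j. r * y j) w) < s\<^sup>2 * sq_norm D w"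
      using y that(1) by (simp add: mult.left_commute)
    then show ?thesis using that(2) unfolding mem_col_cone by blast
  qed
  \<comment> \<open>The converse is the same implication with factor \<open>1 / r\<close>.\<close>
  show ?thesis
    using *[of r w v] *[of "1 / r" v w] assms by (auto simp: field_simps)
qed

lemma measurable_sq_norm [measurable]: "sq_norm D \<in> borel_measurable (RV D)"
  unfolding sq_norm_def[abs_def] by measurable

lemma measurable_sq_norm_affine_emb [measurable]:
  assumes "d \<le> e"
    and [measurable]: "f \<in> measurable N (RM D e)" "g \<in> measurable N (RV D)"
  shows "(\<lambda>x. sq_norm D (affine_emb D d (f x) y (g x))) \<in> borel_measurable N"
proof -
  have [measurable]: "(\<lambda>x. f x (i, j)) \<in> borel_measurable N" if "i < D" "j < d" for i j
    using that assms(1) by (intro measurable_compose[OF assms(2) measurable_component_singleton]) auto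
  have [measurable]: "(\<lambda>x. g x i) \<in> borel_measurable N" if "i < D" for i
    using that by (intro measurable_compose[OF assms(3) measurable_component_singleton]) auto
  show ?thesis
    unfolding sq_norm_affine_emb
    by (intro borel_measurable_sum borel_measurable_power borel_measurable_add borel_measurable_times
        borel_measurable_const) auto
qed

lemma countable_rational_vectors [simp]: "countable (PiE {..<d::nat} (\<lambda>_. \<rat> :: real set))"
  by (intro countable_PiE) (auto intro: countable_rat)

lemma measurable_col_cone [measurable]:
  assumes [measurable]: "f \<in> measurable N (RM D d)" "g \<in> measurable N (RV D)"
  shows "Measurable.pred N (\<lambda>x. g x \<in> col_cone D d s (f x))"
proof -
  have [measurable]: "(\<lambda>x. sq_norm D (affine_emb D d (f x) y (g x))) \<in> borel_measurable N" for y
    using assms by (intro measurable_sq_norm_affine_emb[of d d]) auto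
  have "Measurable.pred N (\<lambda>x. \<exists>y\<in>PiE {..<d} (\<lambda>_. \<rat>).
      sq_norm D (affine_emb D d (f x) y (g x)) < s\<^sup>2 * sq_norm D (g x))"
    unfolding pred_def by (intro sets.sets_Collect_countable_Ex' countable_rational_vectors) measurable
  moreover have "g x \<in> space (RV D)" if "x \<in> space N" for x
    using assms(2) that by (rule measurable_space)
  ultimately show ?thesis
    unfolding col_cone_def by (auto cong: measurable_cong)
qed

section \<open>Averaging over directions: from a random matrix to a random vector\<close>

definition cone_prob :: "nat \<Rightarrow> nat \<Rightarrow> real \<Rightarrow> (nat \<Rightarrow> real) \<Rightarrow> ennreal" where
  "cone_prob D d s v = emeasure (gauss ({..<D} \<times> {..<d}))
     {A \<in> space (gauss ({..<D} \<times> {..<d})). v \<in> col_cone D d s A}"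

text \<open>Rotating the vector and the rows of the matrix together keeps the cone condition, and
  rotating the rows keeps the law of the matrix.\<close>

lemma cone_prob_givens:
  assumes ab: "a < D" "b < D" "a \<noteq> b" and cs: "c\<^sup>2 + t\<^sup>2 = 1" "c \<noteq> -1" and v: "v \<in> space (RV D)"
  shows "cone_prob D d s (givens a b c t v) = cone_prob D d s v"
proof -
  let ?G = "gauss ({..<D} \<times> {..<d})" and ?R = "rows_givens a b c t d"
  let ?w = "givens a b c t v"
  have w: "?w \<in> space (RV D)" using ab v by simp
  have R [measurable]: "?R \<in> measurable ?G ?G"
    using rows_givens_measurable[OF ab(1,2) order_refl] by (simp cong: measurable_cong_sets)
  have [measurable]: "{A \<in> space ?G. ?w \<in> col_cone D d s A} \<in> sets ?G"
  proof -
    have "(\<lambda>A. A) \<in> measurable ?G (RM D d)" by (simp cong: measurable_cong_sets)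
    from measurable_col_cone[OF this measurable_const[OF w], where s = s] show ?thesis
      by (simp add: pred_def)
  qed
  have "cone_prob D d s ?w = emeasure (distr ?G ?G ?R) {A \<in> space ?G. ?w \<in> col_cone D d s A}"
    unfolding cone_prob_def using assms by (simp add: distr_rows_givens)
  also have "\<dots> = emeasure ?G (?R -` {A \<in> space ?G. ?w \<in> col_cone D d s A} \<inter> space ?G)"
    by (intro emeasure_distr) measurable
  also have "?R -` {A \<in> space ?G. ?w \<in> col_cone D d s A} \<inter> space ?G =
      {A \<in> space ?G. v \<in> col_cone D d s A}"
    using measurable_space[OF R] ab cs by (auto simp: givens_mem_col_cone simp del: space_gauss)
  finally show ?thesis unfolding cone_prob_def .
qed

lemma sets_col_cone [measurable]:
  assumes "A \<in> space (RM D d)"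
  shows "col_cone D d s A \<in> sets (RV D)"
proof -
  have "Measurable.pred (RV D) (\<lambda>v. v \<in> col_cone D d s A)"
    using assms by measurable
  then have "{v \<in> space (RV D). v \<in> col_cone D d s A} \<in> sets (RV D)"
    by (simp add: pred_def)
  also have "{v \<in> space (RV D). v \<in> col_cone D d s A} = col_cone D d s A"
    by (auto simp: col_cone_def)
  finally show ?thesis .
qed

text \<open>Dual of the invariance of \<open>cone_prob\<close>: here the matrix is fixed, and its
  rotation is compensated by the rotation invariance of the Gaussian vector.\<close>

lemma emeasure_col_cone_rows_givens:
  assumes ab: "a < D" "b < D" "a \<noteq> b" and cs: "c\<^sup>2 + t\<^sup>2 = 1" "c \<noteq> -1" and A: "A \<in> space (RM D d)"
  shows "emeasure (gauss {..<D}) (col_cone D d s (rows_givens a b c t d A)) =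
    emeasure (gauss {..<D}) (col_cone D d s A)"
proof -
  let ?G = "gauss {..<D}" and ?B = "rows_givens a b c t d A"
  have B: "?B \<in> space (RM D d)"
    using rows_givens_measurable[OF ab(1,2) order_refl] A by (rule measurable_space)
  have G: "givens a b c t \<in> measurable ?G ?G"
    using ab givens_measurable[of a "{..<D}" b c t] by (simp cong: measurable_cong_sets)
  have "emeasure ?G (col_cone D d s ?B) = emeasure (distr ?G ?G (givens a b c t)) (col_cone D d s ?B)"
    using ab cs by (simp add: distr_gauss_givens)
  also have "\<dots> = emeasure ?G (givens a b c t -` col_cone D d s ?B \<inter> space ?G)"
    by (intro emeasure_distr G) (use sets_col_cone[OF B] in simp)
  also have "givens a b c t -` col_cone D d s ?B \<inter> space ?G = col_cone D d s A"
  proof (rule set_eqI)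
    fix v
    have "v \<in> col_cone D d s A \<Longrightarrow> v \<in> space ?G"
      unfolding mem_col_cone by (simp add: space_PiM)
    then show "v \<in> givens a b c t -` col_cone D d s ?B \<inter> space ?G \<longleftrightarrow> v \<in> col_cone D d s A"
      using givens_mem_col_cone[OF ab cs(1), of v d s A] by blast
  qed
  finally show ?thesis .
qed

text \<open>In the plane of coordinates \<open>a\<close> and \<open>b\<close> the vector is turned
  onto the axis of \<open>a\<close>, with cosine \<open>x a / r\<close> and sine
  \<open>- x b / r\<close>. If \<open>x b = 0\<close> these could be the excluded half turn or
  involve \<open>r = 0\<close>, so the identity is taken instead.\<close>

lemma givens_eliminates:
  fixes x :: "'i \<Rightarrow> real"
  assumes "a \<noteq> b"
  obtains c s where "c\<^sup>2 + s\<^sup>2 = 1" "c \<noteq> -1" "givens a b c s x b = 0"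
proof (cases "x b = 0")
  case True
  then show ?thesis using that[of 1 0] by (simp add: givens_def)
next
  case False
  define r where "r = sqrt ((x a)\<^sup>2 + (x b)\<^sup>2)"
  have r2: "r\<^sup>2 = (x a)\<^sup>2 + (x b)\<^sup>2" by (simp add: r_def)
  moreover have "(x b)\<^sup>2 > 0" using False by simp
  ultimately have r: "r \<noteq> 0" by (smt (verit) power_zero_numeral sum_power2_gt_zero_iff)
  have 1: "(x a / r)\<^sup>2 + (- x b / r)\<^sup>2 = 1"
  proof -
    have "(x a / r)\<^sup>2 + (- x b / r)\<^sup>2 = ((x a)\<^sup>2 + (x b)\<^sup>2) / r\<^sup>2"
      by (simp add: power_divide add_divide_distrib)
    then show ?thesis using r by (simp flip: r2)
  qed
  have "x a / r \<noteq> -1"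
  proof
    assume "x a / r = -1"
    then have "(x a / r)\<^sup>2 = 1" by simp
    with 1 have "(- x b / r)\<^sup>2 = 0" by linarith
    with r False show False by simp
  qed
  with 1 show ?thesis using that[of "x a / r" "- x b / r"] assms by (simp add: givens_def)
qed

text \<open>Coordinate \<open>m\<close> is cleared by a rotation in the plane of \<open>0\<close>
  and \<open>m\<close>, which leaves the zeros in between untouched. The invariant \<open>P\<close>
  carries along whatever rotations preserve.\<close>

lemma rotate_to_axis:
  assumes P: "\<And>w a b c s. \<lbrakk>w \<in> space (RV D); a < D; b < D; a \<noteq> b; c\<^sup>2 + s\<^sup>2 = 1; c \<noteq> -1; P w\<rbrakk>
      \<Longrightarrow> P (givens a b c s w)"
    and v: "v \<in> space (RV D)" "P v" and m: "0 < m" "m \<le> D"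
  shows "\<exists>w\<in>space (RV D). P w \<and> (\<forall>k. 0 < k \<and> k < m \<longrightarrow> w k = 0)"
  using m
proof (induction m rule: nat_induct_non_zero)
  case 1
  then show ?case using v by (intro bexI[of _ v]) auto
next
  case (Suc m)
  then obtain w where w: "w \<in> space (RV D)" "P w" "\<And>k. 0 < k \<Longrightarrow> k < m \<Longrightarrow> w k = 0"
    by auto
  obtain c s where cs: "c\<^sup>2 + s\<^sup>2 = 1" "c \<noteq> -1" "givens 0 m c s w m = 0"
    using givens_eliminates[of 0 m w] Suc.hyps by auto
  have "P (givens 0 m c s w)"
    using Suc w cs by (intro P) auto
  moreover have "givens 0 m c s w k = 0" if "0 < k" "k < Suc m" for k
    using that w(3) cs(3) by (cases "k = m") (auto simp: givens_def)
  ultimately show ?case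
    using w(1) Suc.prems by (intro bexI[of _ "givens 0 m c s w"]) auto
qed

text \<open>Rotations move \<open>v\<close> to a non-zero multiple of the first unit vector, and the
  cone condition is homogeneous, so the factor drops out.\<close>

lemma cone_prob_const:
  assumes v: "v \<in> space (RV D)" "sq_norm D v \<noteq> 0"
  shows "cone_prob D d s v = cone_prob D d s (\<lambda>i\<in>{..<D}. if i = 0 then 1 else 0)"
proof -
  have D: "0 < D" using v by (cases D) (auto simp: sq_norm_def)
  define P where "P w \<longleftrightarrow> cone_prob D d s w = cone_prob D d s v \<and> sq_norm D w = sq_norm D v" for w
  have "\<exists>w\<in>space (RV D). P w \<and> (\<forall>k. 0 < k \<and> k < D \<longrightarrow> w k = 0)"
    by (rule rotate_to_axis[OF _ v(1)])
      (use D in \<open>auto simp: P_def cone_prob_givens sq_norm_givens\<close>)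
  then obtain w where w: "w \<in> space (RV D)" "P w" "\<And>k. 0 < k \<Longrightarrow> k < D \<Longrightarrow> w k = 0"
    by auto
  let ?e = "\<lambda>i\<in>{..<D}. if i = 0 then 1 else 0 :: real"
  have w0: "w 0 \<noteq> 0"
  proof
    assume "w 0 = 0"
    then have "\<forall>i<D. w i = 0" using w(3) by (metis gr0I)
    then have "sq_norm D w = 0" by (simp add: sq_norm_eq_0_iff)
    then show False using w(2) v(2) by (simp add: P_def)
  qed
  have "w \<in> col_cone D d s A \<longleftrightarrow> ?e \<in> col_cone D d s A" for A
    by (rule scale_mem_col_cone[OF w0 _ w(1)]) (use w(3) in \<open>auto simp: space_PiM\<close>)
  then have "cone_prob D d s w = cone_prob D d s ?e" by (simp add: cone_prob_def)
  then show ?thesis using w(2) by (simp add: P_def)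
qed

text \<open>By Tonelli the left-hand side is the Gaussian average of \<open>cone_prob\<close> over
  vectors. All non-zero vectors give the same value and the zero vector gives 0, which is why an
  inequality is stated: it spares showing that the zero vector is negligible.\<close>

lemma average_cone_prob:
  assumes v: "v \<in> space (RV D)" "sq_norm D v \<noteq> 0"
  shows "(\<integral>\<^sup>+A. emeasure (gauss {..<D}) (col_cone D d s A) \<partial>gauss ({..<D} \<times> {..<d})) \<le> cone_prob D d s v"
proof -
  let ?G = "gauss ({..<D} \<times> {..<d})" and ?V = "gauss {..<D}"
  interpret G: prob_space ?G by (rule prob_space_gauss)
  interpret V: prob_space ?V by (rule prob_space_gauss)
  interpret P: pair_sigma_finite ?G ?V ..
  let ?f = "\<lambda>(A, w). indicator (col_cone D d s A) w :: ennreal"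
  have [measurable]: "?f \<in> borel_measurable (?G \<Otimes>\<^sub>M ?V)"
  proof -
    have "fst \<in> measurable (?G \<Otimes>\<^sub>M ?V) (RM D d)" "snd \<in> measurable (?G \<Otimes>\<^sub>M ?V) (RV D)"
      by (simp_all cong: measurable_cong_sets add: measurable_fst' measurable_snd')
    from measurable_col_cone[OF this, where s = s] show ?thesis
      unfolding case_prod_beta by (simp add: pred_def)
  qed
  have "(\<integral>\<^sup>+A. emeasure ?V (col_cone D d s A) \<partial>?G) = (\<integral>\<^sup>+A. \<integral>\<^sup>+w. ?f (A, w) \<partial>?V \<partial>?G)"
    by (intro nn_integral_cong) (simp add: sets_col_cone space_PiM)
  also have "\<dots> = (\<integral>\<^sup>+w. \<integral>\<^sup>+A. ?f (A, w) \<partial>?G \<partial>?V)"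
    by (intro P.Fubini[symmetric]) measurable
  also have "\<dots> \<le> (\<integral>\<^sup>+w. cone_prob D d s v \<partial>?V)"
  proof (intro nn_integral_mono)
    fix w assume "w \<in> space ?V"
    then have w: "w \<in> space (RV D)" by (simp add: space_PiM)
    have "(\<integral>\<^sup>+A. ?f (A, w) \<partial>?G) = (\<integral>\<^sup>+A. indicator {A \<in> space ?G. w \<in> col_cone D d s A} A \<partial>?G)"
      by (intro nn_integral_cong) (auto simp: indicator_def)
    also have "\<dots> = cone_prob D d s w"
    proof -
      have "(\<lambda>A. A) \<in> measurable ?G (RM D d)" by (simp cong: measurable_cong_sets)
      from measurable_col_cone[OF this measurable_const[OF w], where s = s]
      have "{A \<in> space ?G. w \<in> col_cone D d s A} \<in> sets ?G" by (simp add: pred_def)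
      then show ?thesis unfolding cone_prob_def by (rule nn_integral_indicator)
    qed
    also have "\<dots> \<le> cone_prob D d s v"
    proof (cases "sq_norm D w = 0")
      case True
      then have "w \<notin> col_cone D d s A" for A
        unfolding mem_col_cone by (simp add: not_less)
      then show ?thesis by (simp add: cone_prob_def)
    next
      case False
      then show ?thesis using cone_prob_const[OF v] cone_prob_const[OF w] by simp
    qed
    finally show "(\<integral>\<^sup>+A. ?f (A, w) \<partial>?G) \<le> cone_prob D d s v" .
  qed
  also have "\<dots> = cone_prob D d s v"
    using V.emeasure_space_1 by simp
  finally show ?thesis .
qed

section \<open>Full column rank and reduction to triangular form\<close>

definition col_injective :: "nat \<Rightarrow> nat \<Rightarrow> (nat \<times> nat \<Rightarrow> real) \<Rightarrow> bool" where
  "col_injective D d A \<longleftrightarrow>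
     (\<forall>y. (\<forall>i<D. (\<Sum>j<d. A (i, j) * y j) = 0) \<longrightarrow> (\<forall>j<d. y j = 0))"

definition upper_triangular :: "nat \<Rightarrow> nat \<Rightarrow> (nat \<times> nat \<Rightarrow> real) \<Rightarrow> bool" where
  "upper_triangular D d A \<longleftrightarrow> (\<forall>i<D. \<forall>j<d. j < i \<longrightarrow> A (i, j) = 0)"

text \<open>A rotation of the rows preserves the length of the image of \<open>y\<close>, hence the
  kernel.\<close>

lemma col_injective_rows_givens:
  assumes "a < D" "b < D" "a \<noteq> b" "c\<^sup>2 + s\<^sup>2 = 1" "col_injective D d A"
  shows "col_injective D d (rows_givens a b c s d A)"
  unfolding col_injective_def
proof (intro allI impI)
  fix y j assume y: "\<forall>i<D. (\<Sum>j<d. rows_givens a b c s d A (i, j) * y j) = 0" and j: "j < d"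
  have "givens a b c s (\<lambda>_. 0) = (\<lambda>_. 0)" by (simp add: givens_def fun_eq_iff)
  then have "sq_norm D (affine_emb D d A y (\<lambda>_. 0)) =
      sq_norm D (affine_emb D d (rows_givens a b c s d A) y (\<lambda>_. 0))"
    using sq_norm_affine_emb_rows_givens[OF assms(1-4), of d A y "\<lambda>_. 0"] by simp
  also have "\<dots> = 0" using y by (simp add: sq_norm_affine_emb)
  finally have "\<forall>i<D. (\<Sum>j<d. A (i, j) * y j) = 0"
    by (simp add: sq_norm_eq_0_iff affine_emb_def)
  then show "y j = 0" using assms(5) j unfolding col_injective_def by blast
qed

text \<open>Back substitution by induction on the number \<open>m\<close> of leading columns in use.
  The diagonal entries are non-zero by injectivity: otherwise the induction hypothesis would write
  column \<open>m\<close> as a combination of the earlier ones.\<close>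

lemma upper_triangular_solvable:
  assumes T: "upper_triangular D d T" and inj: "col_injective D d T"
    and m: "m \<le> d" "d \<le> D" and v: "\<And>i. m \<le> i \<Longrightarrow> i < D \<Longrightarrow> v i = 0"
  shows "\<exists>y. (\<forall>k\<ge>m. y k = 0) \<and> (\<forall>i<D. (\<Sum>k<d. T (i, k) * y k) = v i)"
  using m(1) v
proof (induction m arbitrary: v)
  case 0
  then show ?case by (intro exI[of _ "\<lambda>_. 0"]) auto
next
  case (Suc m)
  have upd: "(\<Sum>k<d. T (i, k) * (y(m := z)) k) = (\<Sum>k<d. T (i, k) * y k) + T (i, m) * z"
    if "y m = 0" for y :: "nat \<Rightarrow> real" and z i
  proof -
    have "(\<Sum>k<d. T (i, k) * (y(m := z)) k) = (\<Sum>k<d. T (i, k) * y k + (if k = m then T (i, m) * z else 0))"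
      using that by (intro sum.cong) auto
    then show ?thesis using Suc.prems(1) by (simp add: sum.distrib)
  qed
  have Tm: "T (i, m) = 0" if "m < i" "i < D" for i
    using T that Suc.prems(1) unfolding upper_triangular_def by auto
  have nz: "T (m, m) \<noteq> 0"
  proof
    assume 0: "T (m, m) = 0"
    have "T (i, m) = 0" if "m \<le> i" "i < D" for i
      using that 0 Tm by (cases "i = m") auto
    then obtain y where y: "\<forall>k\<ge>m. y k = 0" "\<forall>i<D. (\<Sum>k<d. T (i, k) * y k) = T (i, m)"
      using Suc.IH[of "\<lambda>i. T (i, m)"] Suc.prems(1) by auto
    \<comment> \<open>Coefficient -1 on column \<open>m\<close> cancels the combination of the
      earlier columns and gives a non-trivial kernel vector.\<close>
    then have "\<forall>i<D. (\<Sum>k<d. T (i, k) * (y(m := -1)) k) = 0"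
      using upd[where y = y and z = "-1"] by simp
    then have "\<forall>j<d. (y(m := -1)) j = 0" using inj unfolding col_injective_def by blast
    from this[rule_format, of m] show False using Suc.prems(1) by simp
  qed
  define z where "z = v m / T (m, m)"
  have "v i - T (i, m) * z = 0" if "m \<le> i" "i < D" for i
    using that Tm nz Suc.prems(2)[of i] by (cases "i = m") (auto simp: z_def)
  then obtain y where y: "\<forall>k\<ge>m. y k = 0" "\<forall>i<D. (\<Sum>k<d. T (i, k) * y k) = v i - T (i, m) * z"
    using Suc.IH[of "\<lambda>i. v i - T (i, m) * z"] Suc.prems(1) by auto
  then show ?case
    using upd[where y = y and z = z] by (intro exI[of _ "y(m := z)"]) auto
qed

definition axis_cone :: "nat \<Rightarrow> nat \<Rightarrow> real \<Rightarrow> (nat \<Rightarrow> real) set" where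
  "axis_cone D d s = {v \<in> space (RV D). (\<Sum>i\<in>{d..<D}. (v i)\<^sup>2) < s\<^sup>2 * sq_norm D v}"

text \<open>The columns of such a \<open>T\<close> span the first \<open>d\<close> coordinate axes,
  so the first \<open>d\<close> coordinates of \<open>v\<close> can be cancelled exactly and only
  the tail remains as distance.\<close>

lemma axis_cone_subset_col_cone:
  assumes T: "upper_triangular D d T" "col_injective D d T" and "d \<le> D"
  shows "axis_cone D d s \<subseteq> col_cone D d s T"
proof
  fix v assume v: "v \<in> axis_cone D d s"
  obtain y where y: "\<And>i. i < D \<Longrightarrow> (\<Sum>k<d. T (i, k) * y k) = (if i < d then - v i else 0)"
    using upper_triangular_solvable[OF T order_refl assms(3), of "\<lambda>i. if i < d then - v i else 0"]
    by auto
  have "sq_norm D (affine_emb D d T y v) = (\<Sum>i<D. if i < d then 0 else (v i)\<^sup>2)"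
    unfolding sq_norm_affine_emb using y by (intro sum.cong) auto
  also have "\<dots> = (\<Sum>i\<in>{d..<D}. (v i)\<^sup>2)"
    by (rule sum.mono_neutral_cong_right) auto
  finally show "v \<in> col_cone D d s T"
    using v unfolding mem_col_cone axis_cone_def by (auto intro!: exI[of _ y])
qed

text \<open>QR factorization by Givens rotations, with an invariant \<open>P\<close>: the outer
  induction runs over columns, the inner one clears the entries below the diagonal by rotating row
  \<open>m\<close> against row \<open>n\<close>.\<close>

lemma triangularize:
  assumes P: "\<And>A a b c s. \<lbrakk>a < D; b < D; a \<noteq> b; c\<^sup>2 + s\<^sup>2 = 1; c \<noteq> -1; P A\<rbrakk>
      \<Longrightarrow> P (rows_givens a b c s d A)"
    and A: "P A" and "m \<le> d" "d \<le> D"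
  shows "\<exists>B. P B \<and> (\<forall>i<D. \<forall>j<m. j < i \<longrightarrow> B (i, j) = 0)"
  using \<open>m \<le> d\<close>
proof (induction m)
  case 0
  then show ?case using A by auto
next
  case (Suc m)
  then obtain B where B: "P B" "\<forall>i<D. \<forall>j<m. j < i \<longrightarrow> B (i, j) = 0" by auto
  have m: "m < d" "m < D" using Suc.prems assms by auto
  have "\<exists>C. P C \<and> (\<forall>i<D. \<forall>j<m. j < i \<longrightarrow> C (i, j) = 0) \<and> (\<forall>i. m < i \<and> i < n \<longrightarrow> C (i, m) = 0)"
    if "Suc m \<le> n" "n \<le> D" for n
    using that
  proof (induction n rule: dec_induct)
    case base
    then show ?case using B by auto
  next
    case (step n)
    then obtain C where C: "P C" "\<forall>i<D. \<forall>j<m. j < i \<longrightarrow> C (i, j) = 0"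
      "\<forall>i. m < i \<and> i < n \<longrightarrow> C (i, m) = 0" by auto
    have n: "m < n" "n < D" using step by auto
    obtain c s where cs: "c\<^sup>2 + s\<^sup>2 = 1" "c \<noteq> -1" "givens m n c s (\<lambda>i. C (i, m)) n = 0"
      using givens_eliminates[of m n "\<lambda>i. C (i, m)"] n by auto
    let ?C = "rows_givens m n c s d C"
    have "P ?C" using C n m cs by (intro P) auto
    \<comment> \<open>Columns already finished have zeros in both rotated rows, since
      \<open>m\<close> and \<open>n\<close> exceed their index.\<close>
    moreover have "?C (i, j) = 0" if "i < D" "j < m" "j < i" for i j
      using that C(2) n m by (auto simp: rows_givens_apply givens_def)
    moreover have "?C (i, m) = 0" if "m < i" "i < Suc n" for i
      using that C(3) n m cs(3) by (cases "i = n") (auto simp: rows_givens_apply givens_def)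
    ultimately show ?case by blast
  qed
  from this[of D] m obtain C where "P C" "\<forall>i<D. \<forall>j<m. j < i \<longrightarrow> C (i, j) = 0"
    "\<forall>i. m < i \<and> i < D \<longrightarrow> C (i, m) = 0" by auto
  then show ?case by (intro exI[of _ C]) (auto simp: less_Suc_eq)
qed

text \<open>Row rotations change neither the injectivity nor the Gaussian measure of the cone, so
  the matrix may be replaced by its triangular form.\<close>

lemma emeasure_col_cone_ge:
  assumes A: "A \<in> space (RM D d)" "col_injective D d A" and "d \<le> D"
  shows "emeasure (gauss {..<D}) (axis_cone D d s) \<le> emeasure (gauss {..<D}) (col_cone D d s A)"
proof -
  define P where "P B \<longleftrightarrow> B \<in> space (RM D d) \<and> col_injective D d B \<and>
    emeasure (gauss {..<D}) (col_cone D d s B) = emeasure (gauss {..<D}) (col_cone D d s A)" for B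
  have "P (rows_givens a b c t d B)"
    if "a < D" "b < D" "a \<noteq> b" "c\<^sup>2 + t\<^sup>2 = 1" "c \<noteq> -1" "P B" for a b c t B
    using that measurable_space[OF rows_givens_measurable[OF that(1,2) order_refl]]
    by (auto simp: P_def col_injective_rows_givens emeasure_col_cone_rows_givens)
  moreover have "P A" using A by (simp add: P_def)
  ultimately obtain T where T: "P T" "upper_triangular D d T"
    using triangularize[of D P d A d] assms(3) unfolding upper_triangular_def by blast
  then have "axis_cone D d s \<subseteq> col_cone D d s T"
    using axis_cone_subset_col_cone assms(3) by (auto simp: P_def)
  then have "emeasure (gauss {..<D}) (axis_cone D d s) \<le> emeasure (gauss {..<D}) (col_cone D d s T)"
    using T by (intro emeasure_mono) (simp_all add: P_def sets_col_cone)
  then show ?thesis using T by (simp add: P_def)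
qed

text \<open>A box, so that its Gaussian measure is a product. The half-width
  \<open>1 / (2 * real d)\<close> makes the top block invertible, and leaving all rows from
  \<open>d\<close> on free makes the measure independent of \<open>D\<close>.\<close>

definition near_identity :: "nat \<Rightarrow> nat \<Rightarrow> (nat \<times> nat \<Rightarrow> real) set" where
  "near_identity D d = PiE ({..<D} \<times> {..<d}) (\<lambda>(i, j).
     if i < d then {of_bool (i = j) - 1 / (2 * real d)<..<of_bool (i = j) + 1 / (2 * real d)} else UNIV)"

text \<open>Read the kernel equation in the row where \<open>y\<close> has its largest absolute
  value \<open>m\<close>: the deviation from the identity contributes at most \<open>d\<close> terms
  of size \<open>m / (2 d)\<close>, so \<open>m \<le> m / 2\<close>.\<close>

lemma near_identity_injective:
  assumes A: "A \<in> near_identity D d" and "d \<le> D"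
  shows "col_injective D d A"
  unfolding col_injective_def
proof (intro allI impI)
  fix y j assume y: "\<forall>i<D. (\<Sum>j<d. A (i, j) * y j) = 0" and j: "j < d"
  define m where "m = Max ((\<lambda>j. \<bar>y j\<bar>) ` {..<d})"
  have fin: "finite ((\<lambda>j. \<bar>y j\<bar>) ` {..<d})" "(\<lambda>j. \<bar>y j\<bar>) ` {..<d} \<noteq> {}" using j by auto
  have le: "\<bar>y k\<bar> \<le> m" if "k < d" for k
    unfolding m_def using fin that by (intro Max_ge) auto
  obtain i where i: "i < d" "\<bar>y i\<bar> = m"
    using Max_in[OF fin] unfolding m_def by auto
  have dev: "\<bar>A (i, k) - of_bool (i = k)\<bar> \<le> 1 / (2 * real d)" if "k < d" for k
  proof -
    have "(i, k) \<in> {..<D} \<times> {..<d}" using i that assms(2) by auto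
    then have "A (i, k) \<in> (case (i, k) of (i, j) \<Rightarrow>
      if i < d then {of_bool (i = j) - 1 / (2 * real d)<..<of_bool (i = j) + 1 / (2 * real d)} else UNIV)"
      using A unfolding near_identity_def by (rule PiE_mem[rotated])
    then show ?thesis using i by auto
  qed
  have "(\<Sum>k<d. of_bool (i = k) * y k) = y i"
    using i by (simp add: of_bool_def if_distrib[of "\<lambda>x. x * _"] cong: if_cong)
  moreover have "(\<Sum>k<d. A (i, k) * y k) = 0" using y i assms(2) by auto
  ultimately have "- y i = (\<Sum>k<d. (A (i, k) - of_bool (i = k)) * y k)"
    by (simp add: left_diff_distrib sum_subtractf)
  also have "\<bar>\<dots>\<bar> \<le> (\<Sum>k<d. \<bar>(A (i, k) - of_bool (i = k)) * y k\<bar>)" by (rule sum_abs)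
  also have "\<dots> \<le> (\<Sum>k<d. 1 / (2 * real d) * m)"
    unfolding abs_mult using dev le by (intro sum_mono mult_mono) auto
  also have "\<dots> = m / 2" using j by simp
  finally have "m \<le> m / 2" using i by simp
  then show "y j = 0" using le[OF j] by simp
qed

text \<open>Each of the \<open>d * d\<close> constrained entries ranges over an interval of length
  \<open>1 / d\<close> inside [-2, 2], where the normal density is at least its value at 2.\<close>

definition near_identity_bound :: "nat \<Rightarrow> real" where
  "near_identity_bound d = (std_normal_density 2 / real d) ^ (d * d)"

lemma near_identity_bound_pos: "d \<ge> 1 \<Longrightarrow> near_identity_bound d > 0"
  unfolding near_identity_bound_def by (intro zero_less_power divide_pos_pos normal_density_pos) auto

lemma normal_interval_ge:
  assumes "0 \<le> h" "\<bar>m\<bar> + h \<le> 2"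
  shows "emeasure (density lborel (\<lambda>t. ennreal (std_normal_density t))) {m - h<..<m + h} \<ge>
    ennreal (std_normal_density 2 * (2 * h))"
proof -
  have "ennreal (std_normal_density 2 * (2 * h)) = (\<integral>\<^sup>+t. ennreal (std_normal_density 2) * indicator {m - h<..<m + h} t \<partial>lborel)"
    using assms by (simp add: nn_integral_cmult_indicator ennreal_mult)
  also have "\<dots> \<le> (\<integral>\<^sup>+t. ennreal (std_normal_density t) * indicator {m - h<..<m + h} t \<partial>lborel)"
  proof (intro nn_integral_mono)
    fix t :: real
    have "std_normal_density 2 \<le> std_normal_density t" if "t \<in> {m - h<..<m + h}"
    proof -
      have "\<bar>t\<bar> \<le> \<bar>2\<bar>" using that assms by auto
      then have "t\<^sup>2 \<le> 2\<^sup>2" by (rule abs_le_square_iff[THEN iffD1])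
      then show ?thesis by (simp add: std_normal_density_def divide_right_mono)
    qed
    then show "ennreal (std_normal_density 2) * indicator {m - h<..<m + h} t \<le>
        ennreal (std_normal_density t) * indicator {m - h<..<m + h} t"
      by (auto simp: indicator_def intro: ennreal_leI)
  qed
  also have "\<dots> = emeasure (density lborel (\<lambda>t. ennreal (std_normal_density t))) {m - h<..<m + h}"
    by (simp add: emeasure_density)
  finally show ?thesis .
qed

lemma emeasure_near_identity:
  assumes d: "1 \<le> d" "d \<le> D"
  shows "ennreal (near_identity_bound d) \<le> emeasure (gauss ({..<D} \<times> {..<d})) (near_identity D d)"
proof -
  let ?N = "density lborel (\<lambda>t. ennreal (std_normal_density t))"
  let ?U = "\<lambda>(i, j). if i < d then {of_bool (i = j) - 1 / (2 * real d)<..<of_bool (i = j) + 1 / (2 * real d)} else UNIV"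
  have UN: "emeasure ?N UNIV = 1"
    using prob_space.emeasure_space_1[OF prob_space_normal_density[of 1 0]] by simp
  have "ennreal (near_identity_bound d) = (\<Prod>ij\<in>{..<d} \<times> {..<d}. ennreal (std_normal_density 2 / real d))"
    by (simp add: near_identity_bound_def ennreal_power card_cartesian_product)
  \<comment> \<open>The free rows contribute factors 1; this is where \<open>D\<close> disappears
    from the bound.\<close>
  also have "\<dots> = (\<Prod>ij\<in>{..<D} \<times> {..<d}. if fst ij < d then ennreal (std_normal_density 2 / real d) else 1)"
    using d by (intro prod.mono_neutral_cong_left) auto
  also have "\<dots> \<le> (\<Prod>ij\<in>{..<D} \<times> {..<d}. emeasure ?N (?U ij))"
  proof (rule prod_mono_ennreal)
    fix ij :: "nat \<times> nat" assume ij: "ij \<in> {..<D} \<times> {..<d}"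
    obtain i j where [simp]: "ij = (i, j)" by (cases ij)
    have h: "\<bar>of_bool (i = j)\<bar> + 1 / (2 * real d) \<le> (2::real)"
      using d by (auto simp: of_bool_def field_simps)
    show "(if fst ij < d then ennreal (std_normal_density 2 / real d) else 1) \<le> emeasure ?N (?U ij)"
      using normal_interval_ge[of "1 / (2 * real d)" "of_bool (i = j)"] h UN by auto
  qed
  also have "\<dots> = emeasure (gauss ({..<D} \<times> {..<d})) (near_identity D d)"
    unfolding gauss_def near_identity_def by (intro normal_prod.emeasure_PiM[symmetric]) auto
  finally show ?thesis .
qed

text \<open>The average over all matrices is bounded below by the part over
  \<open>near_identity\<close>, where every cone has at least the measure of
  \<open>axis_cone\<close>.\<close>

lemma cone_prob_ge:
  assumes d: "1 \<le> d" "d \<le> D" and v: "v \<in> space (RV D)" "sq_norm D v \<noteq> 0"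
  shows "ennreal (near_identity_bound d) * emeasure (gauss {..<D}) (axis_cone D d s) \<le> cone_prob D d s v"
proof -
  let ?G = "gauss ({..<D} \<times> {..<d})" and ?N = "near_identity D d"
  have N [measurable]: "?N \<in> sets ?G"
    unfolding near_identity_def sets_gauss by (intro sets_PiM_I_finite) auto
  have "ennreal (near_identity_bound d) * emeasure (gauss {..<D}) (axis_cone D d s) \<le>
      emeasure ?G ?N * emeasure (gauss {..<D}) (axis_cone D d s)"
    using emeasure_near_identity[OF d] by (intro mult_right_mono) auto
  also have "\<dots> = (\<integral>\<^sup>+A. emeasure (gauss {..<D}) (axis_cone D d s) * indicator ?N A \<partial>?G)"
    by (subst nn_integral_cmult_indicator[OF N]) (rule mult.commute)
  also have "\<dots> \<le> (\<integral>\<^sup>+A. emeasure (gauss {..<D}) (col_cone D d s A) \<partial>?G)"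
  proof (intro nn_integral_mono)
    fix A assume "A \<in> space ?G"
    then show "emeasure (gauss {..<D}) (axis_cone D d s) * indicator ?N A \<le>
        emeasure (gauss {..<D}) (col_cone D d s A)"
      using emeasure_col_cone_ge[of A D d s] near_identity_injective[of A D d] d
      by (auto simp: indicator_def space_PiM)
  qed
  also have "\<dots> \<le> cone_prob D d s v"
    by (rule average_cone_prob[OF v])
  finally show ?thesis .
qed

section \<open>Gaussian measure of a cone\<close>

definition centered_ball :: "'i set \<Rightarrow> real \<Rightarrow> ('i \<Rightarrow> real) set" where
  "centered_ball I r = {x \<in> PiE I (\<lambda>_. UNIV). sqrt (\<Sum>i\<in>I. (x i)\<^sup>2) \<le> r}"

lemma centered_ball_mono: "r \<le> t \<Longrightarrow> centered_ball I r \<subseteq> centered_ball I t"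
  unfolding centered_ball_def by (blast intro: order_trans)

lemma centered_ball_alt:
  "centered_ball I r = {x. sqrt (\<Sum>i\<in>I. (x i)\<^sup>2) \<le> r} \<inter> space (\<Pi>\<^sub>M i\<in>I. lborel)"
  by (auto simp: centered_ball_def space_PiM)

lemma sets_centered_ball [measurable]: "centered_ball I r \<in> sets (\<Pi>\<^sub>M i\<in>I. borel)"
proof -
  have "{x \<in> space (\<Pi>\<^sub>M i\<in>I. borel). sqrt (\<Sum>i\<in>I. (x i)\<^sup>2) \<le> r} \<in> sets (\<Pi>\<^sub>M i\<in>I. (borel :: real measure))"
    by measurable
  then show ?thesis by (simp add: centered_ball_def space_PiM)
qed

lemma emeasure_centered_ball:
  assumes "finite I" "r > 0"
  shows "emeasure (\<Pi>\<^sub>M i\<in>I. lborel) (centered_ball I r) = ennreal (unit_ball_vol (real (card I)) * r ^ card I)"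
  unfolding centered_ball_alt by (rule emeasure_cball_aux[OF assms])

text \<open>The antiderivative is \<open>- exp (- t\<^sup>2 / 2)\<close>. Read backwards, the
  Gaussian profile at radius \<open>r\<close> is the total weight of the balls with radius
  \<open>t \<ge> r\<close>.\<close>

lemma gauss_tail_integral:
  assumes "r \<ge> 0"
  shows "(\<integral>\<^sup>+t. ennreal (t * exp (- t\<^sup>2 / 2)) * indicator {r..} t \<partial>lborel) = ennreal (exp (- r\<^sup>2 / 2))"
proof -
  have "((\<lambda>t. - exp (- t\<^sup>2 / 2) :: real) \<longlongrightarrow> 0) at_top"
    by real_asymp
  moreover have "((\<lambda>t. - exp (- t\<^sup>2 / 2)) has_real_derivative t * exp (- t\<^sup>2 / 2)) (at t)" for t :: real
    by (auto intro!: derivative_eq_intros)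
  ultimately have "(\<integral>\<^sup>+t. ennreal (t * exp (- t\<^sup>2 / 2)) * indicator {r..} t \<partial>lborel) =
      ennreal (0 - (- exp (- r\<^sup>2 / 2)))"
    using assms by (intro nn_integral_FTC_atLeast) auto
  then show ?thesis by simp
qed

text \<open>Layer cake: the Gaussian density is a mixture of uniform densities on balls.\<close>

lemma emeasure_gauss_layers:
  assumes I: "finite I" and S [measurable]: "S \<in> sets (\<Pi>\<^sub>M i\<in>I. borel)"
  shows "emeasure (gauss I) S =
    (\<integral>\<^sup>+t. ennreal ((1 / sqrt (2 * pi)) ^ card I) * ennreal (t * exp (- t\<^sup>2 / 2)) * indicator {0<..} t *
      emeasure (\<Pi>\<^sub>M i\<in>I. lborel) (S \<inter> centered_ball I t) \<partial>lborel)"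
proof -
  let ?L = "\<Pi>\<^sub>M i\<in>I. lborel :: real measure" and ?K = "ennreal ((1 / sqrt (2 * pi)) ^ card I)"
  let ?r = "\<lambda>x. sqrt (\<Sum>i\<in>I. (x i)\<^sup>2)"
  let ?g = "\<lambda>t::real. ennreal (t * exp (- t\<^sup>2 / 2))"
  interpret L: sigma_finite_measure ?L by (rule lborel_prod.sigma_finite[OF I])
  interpret P: pair_sigma_finite ?L "lborel :: real measure" ..
  have S': "S \<in> sets (gauss I)" by simp
  have "emeasure (gauss I) S = (\<integral>\<^sup>+x. indicator S x \<partial>gauss I)"
    using S' by simp
  also have "\<dots> = (\<integral>\<^sup>+x. ennreal (gauss_density I x) * indicator S x \<partial>?L)"
    using I by (intro nn_integral_gauss) measurable
  also have "\<dots> = (\<integral>\<^sup>+x. \<integral>\<^sup>+t. ?K * ?g t * indicator {?r x..} t * indicator S x \<partial>lborel \<partial>?L)"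
  proof (rule nn_integral_cong)
    fix x :: "'a \<Rightarrow> real"
    have r: "?r x \<ge> 0" "(?r x)\<^sup>2 = (\<Sum>i\<in>I. (x i)\<^sup>2)" by (simp_all add: sum_nonneg)
    have "(\<integral>\<^sup>+t. ?K * ?g t * indicator {?r x..} t * indicator S x \<partial>lborel) =
        (\<integral>\<^sup>+t. (?K * indicator S x) * (?g t * indicator {?r x..} t) \<partial>lborel)"
      by (intro nn_integral_cong) (simp add: mult_ac)
    also have "\<dots> = (?K * indicator S x) * (\<integral>\<^sup>+t. ?g t * indicator {?r x..} t \<partial>lborel)"
      by (intro nn_integral_cmult) measurable
    also have "\<dots> = (?K * ennreal (exp (- (?r x)\<^sup>2 / 2))) * indicator S x"
      unfolding gauss_tail_integral[OF r(1)] by (simp add: mult_ac)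
    also have "?K * ennreal (exp (- (?r x)\<^sup>2 / 2)) = ennreal (gauss_density I x)"
      unfolding r(2) gauss_density_def by (simp add: ennreal_mult)
    finally show "ennreal (gauss_density I x) * indicator S x =
        (\<integral>\<^sup>+t. ?K * ?g t * indicator {?r x..} t * indicator S x \<partial>lborel)" by simp
  qed
  also have "\<dots> = (\<integral>\<^sup>+t. \<integral>\<^sup>+x. ?K * ?g t * indicator {?r x..} t * indicator S x \<partial>?L \<partial>lborel)"
  proof (rule P.Fubini'[symmetric])
    have [measurable]: "Measurable.pred (?L \<Otimes>\<^sub>M lborel) (\<lambda>z. ?r (fst z) \<le> snd z)"
      by measurable
    have "(\<lambda>z. ?K * ?g (snd z) * (if ?r (fst z) \<le> snd z then 1 else 0) * indicator S (fst z))
        \<in> borel_measurable (?L \<Otimes>\<^sub>M lborel)" by measurable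
    also have "(\<lambda>z. ?K * ?g (snd z) * (if ?r (fst z) \<le> snd z then 1 else 0) * indicator S (fst z)) =
        (\<lambda>(x, t). ?K * ?g t * indicator {?r x..} t * indicator S x)"
      by (auto simp: fun_eq_iff indicator_def)
    finally show "(\<lambda>(x, t). ?K * ?g t * indicator {?r x..} t * indicator S x)
        \<in> borel_measurable (?L \<Otimes>\<^sub>M lborel)" .
  qed
  also have "\<dots> = (\<integral>\<^sup>+t. ?K * ?g t * indicator {0<..} t * emeasure ?L (S \<inter> centered_ball I t) \<partial>lborel)"
  proof (rule nn_integral_cong)
    fix t :: real
    have "(\<integral>\<^sup>+x. ?K * ?g t * indicator {?r x..} t * indicator S x \<partial>?L) =
        (\<integral>\<^sup>+x. ?K * ?g t * indicator (S \<inter> centered_ball I t) x \<partial>?L)"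
      by (intro nn_integral_cong) (auto simp: indicator_def centered_ball_def space_PiM)
    also have "\<dots> = ?K * ?g t * emeasure ?L (S \<inter> centered_ball I t)"
    proof (rule nn_integral_cmult_indicator)
      have "S \<inter> centered_ball I t \<in> sets (\<Pi>\<^sub>M i\<in>I. borel)" by measurable
      then show "S \<inter> centered_ball I t \<in> sets ?L" by (simp add: sets_PiM_lborel)
    qed
    \<comment> \<open>For \<open>t \<le> 0\<close> the weight is non-positive, and
      \<open>ennreal\<close> truncates it to 0.\<close>
    also have "\<dots> = ?K * ?g t * indicator {0<..} t * emeasure ?L (S \<inter> centered_ball I t)"
    proof (cases "t > 0")
      case False
      then have "t * exp (- t\<^sup>2 / 2) \<le> 0" by (simp add: mult_nonpos_nonneg)
      then show ?thesis by (simp add: ennreal_neg)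
    qed simp
    finally show "(\<integral>\<^sup>+x. ?K * ?g t * indicator {?r x..} t * indicator S x \<partial>?L) =
        ?K * ?g t * indicator {0<..} t * emeasure ?L (S \<inter> centered_ball I t)" .
  qed
  finally show ?thesis .
qed

text \<open>A set that occupies at least the fraction \<open>q\<close> of every centered ball
  occupies at least that fraction of any mixture of balls.\<close>

lemma emeasure_gauss_ge:
  assumes I: "finite I" and S [measurable]: "S \<in> sets (\<Pi>\<^sub>M i\<in>I. borel)"
    and vol: "\<And>t. t > 0 \<Longrightarrow> q * emeasure (\<Pi>\<^sub>M i\<in>I. lborel) (centered_ball I t) \<le>
      emeasure (\<Pi>\<^sub>M i\<in>I. lborel) (S \<inter> centered_ball I t)"
  shows "q \<le> emeasure (gauss I) S"
proof -
  let ?L = "\<Pi>\<^sub>M i\<in>I. lborel :: real measure"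
  let ?g = "\<lambda>t::real. ennreal ((1 / sqrt (2 * pi)) ^ card I) * ennreal (t * exp (- t\<^sup>2 / 2)) * indicator {0<..} t"
  let ?U = "PiE I (\<lambda>_. UNIV :: real set)"
  have U: "?U \<in> sets (\<Pi>\<^sub>M i\<in>I. borel)" using I by (intro sets_PiM_I_finite) auto
  have UB: "?U \<inter> centered_ball I t = centered_ball I t" for t by (auto simp: centered_ball_def)
  have m: "(\<lambda>t. ?g t * emeasure ?L (centered_ball I t)) \<in> borel_measurable lborel"
  proof -
    have "(\<lambda>t. ?g t * ennreal (unit_ball_vol (real (card I)) * t ^ card I)) \<in> borel_measurable lborel"
      by measurable
    also have "(\<lambda>t. ?g t * ennreal (unit_ball_vol (real (card I)) * t ^ card I)) =
        (\<lambda>t. ?g t * emeasure ?L (centered_ball I t))"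
      using I by (auto simp: fun_eq_iff indicator_def emeasure_centered_ball)
    finally show ?thesis .
  qed
  \<comment> \<open>The layer formula for the whole space shows that the total weight is 1, without
    computing any constant.\<close>
  have "1 = emeasure (gauss I) ?U"
    using prob_space.emeasure_space_1[OF prob_space_gauss[of I]] by simp
  also have "\<dots> = (\<integral>\<^sup>+t. ?g t * emeasure ?L (centered_ball I t) \<partial>lborel)"
    unfolding emeasure_gauss_layers[OF I U] UB ..
  finally have "q = q * (\<integral>\<^sup>+t. ?g t * emeasure ?L (centered_ball I t) \<partial>lborel)" by simp
  also have "\<dots> = (\<integral>\<^sup>+t. q * (?g t * emeasure ?L (centered_ball I t)) \<partial>lborel)"
    by (rule nn_integral_cmult[OF m, symmetric])
  also have "\<dots> \<le> (\<integral>\<^sup>+t. ?g t * emeasure ?L (S \<inter> centered_ball I t) \<partial>lborel)"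
  proof (rule nn_integral_mono)
    fix t :: real
    show "q * (?g t * emeasure ?L (centered_ball I t)) \<le> ?g t * emeasure ?L (S \<inter> centered_ball I t)"
    proof (cases "t > 0")
      case True
      have "q * (?g t * emeasure ?L (centered_ball I t)) = ?g t * (q * emeasure ?L (centered_ball I t))"
        by (simp add: mult_ac)
      also have "\<dots> \<le> ?g t * emeasure ?L (S \<inter> centered_ball I t)"
        by (intro mult_left_mono vol True) simp
      finally show ?thesis .
    qed simp
  qed
  also have "\<dots> = emeasure (gauss I) S"
    by (rule emeasure_gauss_layers[OF I S, symmetric])
  finally show ?thesis .
qed

text \<open>Lower bound for the fraction of a ball inside the cone. The radii of the two factors are
  in proportion \<open>sqrt (1 - s\<^sup>2)\<close> and \<open>s\<close> to that of the ball, and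
  \<open>exp (-1) / D\<close> pays for passing to a shell and shrinking the second ball.\<close>

definition axis_cone_bound :: "nat \<Rightarrow> nat \<Rightarrow> real \<Rightarrow> real" where
  "axis_cone_bound D d s =
     unit_ball_vol d * unit_ball_vol (D - d) / unit_ball_vol D * sqrt (1 - s\<^sup>2) ^ d * s ^ (D - d) * exp (-1) / D"

lemma axis_cone_bound_pos:
  assumes "0 < s" "s < 1" "0 < D"
  shows "axis_cone_bound D d s > 0"
proof -
  have "s\<^sup>2 < 1" using assms by (simp add: abs_square_less_1)
  then show ?thesis
    unfolding axis_cone_bound_def using assms by (intro divide_pos_pos mult_pos_pos zero_less_power) auto
qed

text \<open>The shrinking factor \<open>n / (n + 1)\<close> balances two losses: its
  \<open>n\<close>-th power stays above \<open>1 / e\<close>, while the shell it cuts off still has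
  relative volume at least \<open>1 / (n + 1)\<close>.\<close>

lemma power_shell_bounds:
  fixes n d :: nat
  assumes "1 \<le> d"
  defines "\<theta> \<equiv> real n / (real n + 1)"
  shows "exp (-1) \<le> \<theta> ^ n" "1 / (real n + 1) \<le> 1 - \<theta> ^ d" "0 \<le> \<theta>" "\<theta> \<le> 1"
proof -
  show \<theta>: "0 \<le> \<theta>" "\<theta> \<le> 1" by (auto simp: \<theta>_def)
  have "\<theta> ^ d \<le> \<theta> ^ 1" using \<theta> assms(1) by (intro power_decreasing) auto
  also have "\<dots> = 1 - 1 / (real n + 1)" by (simp add: \<theta>_def field_simps)
  finally show "1 / (real n + 1) \<le> 1 - \<theta> ^ d" by simp
  show "exp (-1) \<le> \<theta> ^ n"
  proof (cases "n = 0")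
    case False
    then have n: "real n > 0" by simp
    have "(1 / \<theta>) ^ n = (1 + 1 / real n) ^ n" using n by (simp add: \<theta>_def field_simps)
    also have "\<dots> \<le> exp (1 / real n) ^ n"
      by (intro power_mono) auto
    also have "\<dots> = exp 1" using n by (simp flip: exp_of_nat_mult)
    finally have "1 / exp 1 \<le> 1 / (1 / \<theta>) ^ n"
      using n by (intro divide_left_mono) (auto simp: \<theta>_def)
    then show ?thesis by (simp add: exp_minus divide_inverse flip: power_inverse)
  qed simp
qed

lemma sets_axis_cone [measurable]: "axis_cone D d s \<in> sets (RV D)"
proof -
  have [measurable]: "(\<lambda>v. v i) \<in> borel_measurable (RV D)" if "i \<in> {d..<D}" for i
    using that by (intro measurable_component_singleton) auto
  show ?thesis unfolding axis_cone_def by measurable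
qed

text \<open>The set contains the product of a shell \<open>E\<close> in the first \<open>d\<close>
  coordinates and a ball \<open>F\<close> in the others. The shell keeps the first part long enough
  for the cone condition, and the volume of a product is explicit.\<close>

lemma volume_axis_cone_ball:
  assumes d: "1 \<le> d" "d < D" and s: "0 < s" "s < 1" and t: "t > 0"
  shows "ennreal (axis_cone_bound D d s) * emeasure (\<Pi>\<^sub>M i\<in>{..<D}. lborel) (centered_ball {..<D} t) \<le>
    emeasure (\<Pi>\<^sub>M i\<in>{..<D}. lborel) (axis_cone D d s \<inter> centered_ball {..<D} t)"
proof -
  let ?J = "{..<d}" and ?K = "{d..<D}"
  let ?LJ = "\<Pi>\<^sub>M i\<in>?J. lborel :: real measure" and ?LK = "\<Pi>\<^sub>M i\<in>?K. lborel :: real measure"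
  let ?L = "\<Pi>\<^sub>M i\<in>{..<D}. lborel :: real measure"
  define n where "n = D - d"
  define \<theta> where "\<theta> = real n / (real n + 1)"
  have th: "exp (-1) \<le> \<theta> ^ n" "1 / (real n + 1) \<le> 1 - \<theta> ^ d" "0 \<le> \<theta>" "\<theta> \<le> 1"
    unfolding \<theta>_def using power_shell_bounds[OF d(1), of n] by auto
  define \<rho> where "\<rho> = sqrt (1 - s\<^sup>2)"
  have s2: "s\<^sup>2 < 1" using s by (simp add: abs_square_less_1)
  then have \<rho>: "\<rho> > 0" "\<rho>\<^sup>2 = 1 - s\<^sup>2" by (auto simp: \<rho>_def)
  interpret LK: sigma_finite_measure ?LK by (rule lborel_prod.sigma_finite) simp
  interpret LJ: sigma_finite_measure ?LJ by (rule lborel_prod.sigma_finite) simp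
  have "n \<noteq> 0" using d by (simp add: n_def)
  then have th0: "\<theta> > 0" "\<theta> < 1" by (auto simp: \<theta>_def)
  \<comment> \<open>The outer radii \<open>t * \<rho>\<close> and \<open>t * s\<close> are the legs
    of a right triangle with hypotenuse \<open>t\<close>, so the product stays in the ball;
    shrinking \<open>a\<close> and \<open>e\<close> by the same \<theta> keeps
    \<open>\<rho> * e = s * a\<close>.\<close>
  define b a e where "b = t * \<rho>" and "a = t * \<rho> * \<theta>" and "e = t * s * \<theta>"
  have pos: "a > 0" "b > 0" "e > 0" "a \<le> b"
    using t \<rho> th0 s by (auto simp: a_def b_def e_def)
  define E where "E = centered_ball ?J b - centered_ball ?J a"
  define F where "F = centered_ball ?K e"
  have E: "E \<in> sets ?LJ" unfolding E_def by (simp add: sets_PiM_lborel)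
  have F: "F \<in> sets ?LK" unfolding F_def by (simp add: sets_PiM_lborel)
  have "emeasure ?LJ E = emeasure ?LJ (centered_ball ?J b) - emeasure ?LJ (centered_ball ?J a)"
    unfolding E_def
  proof (rule emeasure_Diff)
    show "emeasure ?LJ (centered_ball ?J a) \<noteq> \<infinity>" using pos by (simp add: emeasure_centered_ball)
    show "centered_ball ?J a \<subseteq> centered_ball ?J b" using pos by (intro centered_ball_mono)
  qed (simp_all add: sets_PiM_lborel)
  also have "\<dots> = ennreal (unit_ball_vol d * (b ^ d - a ^ d))"
    using pos by (simp add: emeasure_centered_ball right_diff_distrib ennreal_minus)
  finally have vE: "emeasure ?LJ E = ennreal (unit_ball_vol d * (b ^ d - a ^ d))" .
  have vF: "emeasure ?LK F = ennreal (unit_ball_vol n * e ^ n)"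
    unfolding F_def using pos by (simp add: emeasure_centered_ball n_def)
  have U: "?J \<union> ?K = {..<D}" using d by auto
  have sub: "E \<times> F \<subseteq> merge ?J ?K -` (axis_cone D d s \<inter> centered_ball {..<D} t) \<inter> space (?LJ \<Otimes>\<^sub>M ?LK)"
  proof (rule subsetI)
    fix u assume "u \<in> E \<times> F"
    then obtain x z where u: "u = (x, z)" and x: "x \<in> E" and z: "z \<in> F" by auto
    let ?w = "merge ?J ?K (x, z)"
    have xz: "x \<in> PiE ?J (\<lambda>_. UNIV)" "z \<in> PiE ?K (\<lambda>_. UNIV)"
      using x z by (auto simp: E_def F_def centered_ball_def)
    then have sp: "(x, z) \<in> space (?LJ \<Otimes>\<^sub>M ?LK)" by (simp add: space_pair_measure space_PiM)
    have w: "?w \<in> PiE {..<D} (\<lambda>_. UNIV)"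
      unfolding U[symmetric] by (auto simp: merge_def PiE_iff extensional_def)
    have wJ: "(\<Sum>i\<in>?J. (?w i)\<^sup>2) = (\<Sum>i\<in>?J. (x i)\<^sup>2)"
      by (intro sum.cong) (auto simp: merge_def)
    have wK: "(\<Sum>i\<in>?K. (?w i)\<^sup>2) = (\<Sum>i\<in>?K. (z i)\<^sup>2)"
      by (intro sum.cong) (auto simp: merge_def)
    have wD: "(\<Sum>i<D. (?w i)\<^sup>2) = (\<Sum>i\<in>?J. (x i)\<^sup>2) + (\<Sum>i\<in>?K. (z i)\<^sup>2)"
      unfolding U[symmetric] wJ[symmetric] wK[symmetric] by (intro sum.union_disjoint) auto
    define X Z where "X = (\<Sum>i\<in>?J. (x i)\<^sup>2)" and "Z = (\<Sum>i\<in>?K. (z i)\<^sup>2)"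
    have nn: "X \<ge> 0" "Z \<ge> 0" by (auto simp: X_def Z_def sum_nonneg)
    have "sqrt X \<le> b" "a < sqrt X" "sqrt Z \<le> e"
      using x z by (auto simp: E_def F_def centered_ball_def X_def Z_def)
    then have sq: "X \<le> b\<^sup>2" "a\<^sup>2 < X" "Z \<le> e\<^sup>2"
      using nn pos power_strict_mono[of a "sqrt X" 2] by (simp_all add: sqrt_le_D)
    \<comment> \<open>With \<open>\<rho>\<^sup>2 = 1 - s\<^sup>2\<close> the cone condition
      \<open>Z < s\<^sup>2 * (X + Z)\<close> is equivalent to
      \<open>\<rho>\<^sup>2 * Z < s\<^sup>2 * X\<close>.\<close>
    have "\<rho>\<^sup>2 * Z \<le> \<rho>\<^sup>2 * e\<^sup>2" using sq by (intro mult_left_mono) auto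
    also have "\<dots> = s\<^sup>2 * a\<^sup>2" by (simp add: a_def e_def power_mult_distrib mult_ac)
    also have "\<dots> < s\<^sup>2 * X" using sq s by (intro mult_strict_left_mono) auto
    finally have "Z < s\<^sup>2 * (X + Z)" unfolding \<rho> by (simp add: algebra_simps)
    then have ac: "?w \<in> axis_cone D d s"
      using w unfolding axis_cone_def mem_Collect_eq sq_norm_def wK wD X_def Z_def by (simp add: space_PiM)
    have "e\<^sup>2 \<le> (t * s)\<^sup>2" unfolding e_def using th t s by (intro power_mono mult_left_le) auto
    then have "X + Z \<le> b\<^sup>2 + (t * s)\<^sup>2" using sq by simp
    also have "\<dots> = t\<^sup>2" unfolding b_def power_mult_distrib \<rho> by (simp add: algebra_simps)
    finally have "sqrt (X + Z) \<le> t" using t by (simp add: real_le_lsqrt)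
    then have "?w \<in> centered_ball {..<D} t"
      using w unfolding centered_ball_def mem_Collect_eq wD X_def Z_def by simp
    with ac sp show "u \<in> merge ?J ?K -` (axis_cone D d s \<inter> centered_ball {..<D} t) \<inter> space (?LJ \<Otimes>\<^sub>M ?LK)"
      unfolding u by simp
  qed
  have tD: "t ^ D = t ^ d * t ^ n" using d by (simp add: n_def flip: power_add)
  have "axis_cone_bound D d s * (unit_ball_vol D * t ^ D) =
      unit_ball_vol d * unit_ball_vol n * \<rho> ^ d * s ^ n * t ^ D * (exp (-1) * (1 / D))"
    using unit_ball_vol_pos[of D] by (simp add: axis_cone_bound_def n_def \<rho>_def less_imp_neq[symmetric])
  also have "\<dots> \<le> unit_ball_vol d * unit_ball_vol n * \<rho> ^ d * s ^ n * t ^ D * (\<theta> ^ n * (1 - \<theta> ^ d))"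
  proof (intro mult_left_mono mult_mono)
    \<comment> \<open>\<open>n + 1 \<le> D\<close> because at least one coordinate belongs to the
      first block.\<close>
    have "1 / real D \<le> 1 / (real n + 1)" using d by (intro divide_left_mono) (auto simp: n_def of_nat_diff)
    then show "1 / real D \<le> 1 - \<theta> ^ d" using th by linarith
  qed (use th \<rho> s t in auto)
  also have "\<dots> =
      unit_ball_vol d * (b ^ d - a ^ d) * (unit_ball_vol n * e ^ n)"
    by (simp add: a_def b_def e_def tD power_mult_distrib algebra_simps)
  finally have le: "axis_cone_bound D d s * (unit_ball_vol D * t ^ D) \<le>
      unit_ball_vol d * (b ^ d - a ^ d) * (unit_ball_vol n * e ^ n)" .
  have "ennreal (axis_cone_bound D d s) * emeasure ?L (centered_ball {..<D} t) =
      ennreal (axis_cone_bound D d s * (unit_ball_vol D * t ^ D))"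
    using t d axis_cone_bound_pos[OF s, of D d] by (simp add: emeasure_centered_ball ennreal_mult)
  also have "\<dots> \<le> ennreal (unit_ball_vol d * (b ^ d - a ^ d) * (unit_ball_vol n * e ^ n))"
    using le by (rule ennreal_leI)
  also have "\<dots> = emeasure ?LJ E * emeasure ?LK F"
    unfolding vE vF using pos by (intro ennreal_mult mult_nonneg_nonneg) (auto intro: power_mono)
  also have "\<dots> = emeasure (?LJ \<Otimes>\<^sub>M ?LK) (E \<times> F)"
    using E F by (rule LK.emeasure_pair_measure_Times[symmetric])
  also have "\<dots> \<le> emeasure (?LJ \<Otimes>\<^sub>M ?LK)
      (merge ?J ?K -` (axis_cone D d s \<inter> centered_ball {..<D} t) \<inter> space (?LJ \<Otimes>\<^sub>M ?LK))"
  proof (rule emeasure_mono[OF sub])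
    have "axis_cone D d s \<inter> centered_ball {..<D} t \<in> sets (RV D)" by measurable
    then have "axis_cone D d s \<inter> centered_ball {..<D} t \<in> sets (\<Pi>\<^sub>M i\<in>?J \<union> ?K. lborel)"
      unfolding U by (simp add: sets_PiM_lborel)
    then show "merge ?J ?K -` (axis_cone D d s \<inter> centered_ball {..<D} t) \<inter> space (?LJ \<Otimes>\<^sub>M ?LK)
        \<in> sets (?LJ \<Otimes>\<^sub>M ?LK)"
      by (rule measurable_sets[OF measurable_merge])
  qed
  also have "\<dots> = emeasure (distr (?LJ \<Otimes>\<^sub>M ?LK) (\<Pi>\<^sub>M i\<in>?J \<union> ?K. lborel) (merge ?J ?K))
      (axis_cone D d s \<inter> centered_ball {..<D} t)"
  proof (rule emeasure_distr[symmetric])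
    have "axis_cone D d s \<inter> centered_ball {..<D} t \<in> sets (RV D)" by measurable
    then show "axis_cone D d s \<inter> centered_ball {..<D} t \<in> sets (\<Pi>\<^sub>M i\<in>?J \<union> ?K. lborel)"
      unfolding U by (simp add: sets_PiM_lborel)
  qed (rule measurable_merge)
  also have "\<dots> = emeasure ?L (axis_cone D d s \<inter> centered_ball {..<D} t)"
    by (subst lborel_prod.distr_merge) (auto simp: U)
  finally show ?thesis .
qed

lemma emeasure_axis_cone_ge:
  assumes "1 \<le> d" "d < D" "0 < s" "s < 1"
  shows "ennreal (axis_cone_bound D d s) \<le> emeasure (gauss {..<D}) (axis_cone D d s)"
  using assms by (intro emeasure_gauss_ge volume_axis_cone_ball) auto

section \<open>The stochastic process\<close>

text \<open>Variant of \<open>col_cone\<close> with an absolute radius in place of one proportional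
  to the length of \<open>v\<close>; rational coefficients again keep the condition
  measurable.\<close>

definition near_point :: "nat \<Rightarrow> nat \<Rightarrow> real \<Rightarrow> (nat \<times> nat \<Rightarrow> real) \<Rightarrow> (nat \<Rightarrow> real) \<Rightarrow> bool" where
  "near_point D d r A v \<longleftrightarrow>
     (\<exists>y\<in>PiE {..<d} (\<lambda>_. \<rat>). sq_norm D (affine_emb D d A y v) < r\<^sup>2)"

definition hit_bound :: "nat \<Rightarrow> nat \<Rightarrow> real \<Rightarrow> real" where
  "hit_bound D d s = near_identity_bound d * axis_cone_bound D d s"

lemma hit_bound_pos:
  assumes "1 \<le> d" "d < D" "0 < s" "s < 1"
  shows "hit_bound D d s > 0"
  unfolding hit_bound_def using assms
  by (intro mult_pos_pos near_identity_bound_pos axis_cone_bound_pos) auto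

lemma measurable_near_point [measurable]:
  assumes [measurable]: "f \<in> measurable N (RM D d)" "g \<in> measurable N (RV D)"
  shows "Measurable.pred N (\<lambda>x. near_point D d r (f x) (g x))"
proof -
  have [measurable]: "(\<lambda>x. sq_norm D (affine_emb D d (f x) y (g x))) \<in> borel_measurable N" for y
    using assms by (intro measurable_sq_norm_affine_emb[of d d]) auto
  show ?thesis
    unfolding pred_def near_point_def
    by (intro sets.sets_Collect_countable_Ex' countable_rational_vectors) measurable
qed

lemma hit_bound_le_cone_prob:
  assumes "1 \<le> d" "d < D" "0 < s" "s < 1" and v: "v \<in> space (RV D)" "sq_norm D v \<noteq> 0"
  shows "ennreal (hit_bound D d s) \<le> cone_prob D d s v"
proof -
  have "ennreal (hit_bound D d s) = ennreal (near_identity_bound d) * ennreal (axis_cone_bound D d s)"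
    unfolding hit_bound_def using assms near_identity_bound_pos[of d] axis_cone_bound_pos[of s D d]
    by (intro ennreal_mult) auto
  also have "\<dots> \<le> ennreal (near_identity_bound d) * emeasure (gauss {..<D}) (axis_cone D d s)"
    using assms by (intro mult_left_mono emeasure_axis_cone_ge) auto
  also have "\<dots> \<le> cone_prob D d s v"
    using assms by (intro cone_prob_ge) auto
  finally show ?thesis .
qed

text \<open>For \<open>v\<close> of length at most \<open>R\<close> the relative radius
  \<open>r / R\<close> times the length is at most \<open>r\<close>, so the cone condition implies
  nearness. The zero vector is near for every matrix.\<close>

lemma near_point_prob:
  assumes d: "1 \<le> d" "d < D" and r: "0 < r" "r < R"
    and v: "v \<in> space (RV D)" "sq_norm D v \<le> R\<^sup>2"
  shows "ennreal (hit_bound D d (r / R)) \<le> emeasure (gauss ({..<D} \<times> {..<d}))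
    {A \<in> space (gauss ({..<D} \<times> {..<d})). near_point D d r A v}"
proof -
  let ?G = "gauss ({..<D} \<times> {..<d})"
  let ?s = "r / R"
  have s: "0 < ?s" "?s < 1" using r by auto
  have id: "(\<lambda>A. A) \<in> measurable ?G (RM D d)" by (simp cong: measurable_cong_sets)
  show ?thesis
  proof (cases "sq_norm D v = 0")
    case True
    \<comment> \<open>Any non-zero vector would do: it shows that the bound lies below a
      probability, hence below 1.\<close>
    let ?e = "\<lambda>i\<in>{..<D}. 1 :: real"
    have "sq_norm D ?e \<noteq> 0" using d by (auto simp: sq_norm_eq_0_iff)
    then have "ennreal (hit_bound D d ?s) \<le> cone_prob D d ?s ?e"
      using d s by (intro hit_bound_le_cone_prob) (auto simp: space_PiM)
    also have "\<dots> \<le> 1"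
      unfolding cone_prob_def by (rule prob_space.emeasure_le_1[OF prob_space_gauss])
    also have "1 = emeasure ?G (space ?G)"
      by (rule prob_space.emeasure_space_1[OF prob_space_gauss, symmetric])
    also have "space ?G = {A \<in> space ?G. near_point D d r A v}"
    proof -
      have "sq_norm D (affine_emb D d A (\<lambda>j\<in>{..<d}. 0) v) = 0" for A
        using True unfolding sq_norm_affine_emb by (simp add: sq_norm_def)
      then have "near_point D d r A v" for A
        unfolding near_point_def using r by (intro bexI[of _ "\<lambda>j\<in>{..<d}. 0"]) auto
      then show ?thesis by auto
    qed
    finally show ?thesis .
  next
    case False
    have "?s\<^sup>2 * sq_norm D v \<le> ?s\<^sup>2 * R\<^sup>2" using v by (intro mult_left_mono) auto
    also have "\<dots> = r\<^sup>2" using r by (simp add: power_divide)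
    finally have le: "?s\<^sup>2 * sq_norm D v \<le> r\<^sup>2" .
    have "ennreal (hit_bound D d ?s) \<le> cone_prob D d ?s v"
      using d s v False by (intro hit_bound_le_cone_prob) auto
    also have "\<dots> \<le> emeasure ?G {A \<in> space ?G. near_point D d r A v}"
      unfolding cone_prob_def
    proof (rule emeasure_mono)
      show "{A \<in> space ?G. v \<in> col_cone D d ?s A} \<subseteq> {A \<in> space ?G. near_point D d r A v}"
        using le unfolding col_cone_def near_point_def by (auto intro: less_le_trans)
      show "{A \<in> space ?G. near_point D d r A v} \<in> sets ?G"
        using measurable_near_point[OF id measurable_const[OF v(1)], of r] by (simp add: pred_def)
    qed
    finally show ?thesis .
  qed
qed

section \<open>Euclidean distance and measurability of Lipschitz functions\<close>

lemma euclid_dist_triangle: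
  "euclid_dist D x z \<le> euclid_dist D x w + euclid_dist D w z"
  using L2_set_triangle_ineq[of "\<lambda>i. x i - w i" "\<lambda>i. w i - z i" "{..<D}"]
  by (simp add: euclid_dist_def)

lemma euclid_dist_commute: "euclid_dist D x z = euclid_dist D z x"
  unfolding euclid_dist_def L2_set_def by (simp add: power2_commute)

lemma euclid_dist_nonneg [simp]: "0 \<le> euclid_dist D x z"
  by (simp add: euclid_dist_def)

text \<open>
  McShane extension: \<open>X\<close> is not assumed measurable, so measurability of \<open>f\<close> along the iterates is
  obtained from a Lipschitz extension of \<open>f\<close> to the whole space.
\<close>

lemma lipschitz_measurable_extension:
  assumes "X \<noteq> {}" "0 \<le> L"
    and lip: "\<And>x z. x \<in> X \<Longrightarrow> z \<in> X \<Longrightarrow> \<bar>f x - f z\<bar> \<le> L * euclid_dist D x z"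
  obtains F where "F \<in> borel_measurable (RV D)" "\<And>x. x \<in> X \<Longrightarrow> F x = f x"
proof -
  define F where "F z = (INF x\<in>X. f x + L * euclid_dist D x z)" for z
  obtain x0 where x0: "x0 \<in> X" using assms(1) by auto
  have bdd: "bdd_below ((\<lambda>x. f x + L * euclid_dist D x z) ` X)" for z
  proof (rule bdd_belowI2)
    fix x assume x: "x \<in> X"
    have "L * euclid_dist D x0 x \<le> L * (euclid_dist D x0 z + euclid_dist D x z)"
      using euclid_dist_triangle[of D x0 x z] assms(2)
      by (intro mult_left_mono) (simp_all add: euclid_dist_commute[of D z x])
    then show "f x0 - L * euclid_dist D x0 z \<le> f x + L * euclid_dist D x z"
      using lip[OF x0 x] by (simp add: algebra_simps)
  qed
  have le: "F z \<le> F w + L * euclid_dist D z w" for z w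
  proof -
    have "F z - L * euclid_dist D z w \<le> F w"
      unfolding F_def[of w]
    proof (rule cINF_greatest[OF assms(1)])
      fix x assume x: "x \<in> X"
      have "F z \<le> f x + L * euclid_dist D x z"
        unfolding F_def by (rule cINF_lower[OF bdd x])
      also have "\<dots> \<le> f x + L * (euclid_dist D x w + euclid_dist D z w)"
        using euclid_dist_triangle[of D x z w] assms(2)
        by (intro add_left_mono mult_left_mono) (simp_all add: euclid_dist_commute[of D w z])
      finally show "F z - L * euclid_dist D z w \<le> f x + L * euclid_dist D x w"
        by (simp add: algebra_simps)
    qed
    then show ?thesis by simp
  qed
  have eq: "F x = f x" if x: "x \<in> X" for x
  proof (rule antisym)
    have "F x \<le> f x + L * euclid_dist D x x"
      unfolding F_def by (rule cINF_lower[OF bdd x])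
    then show "F x \<le> f x" by (simp add: euclid_dist_def L2_set_def)
    show "f x \<le> F x"
      unfolding F_def
    proof (rule cINF_greatest[OF assms(1)])
      fix z assume "z \<in> X"
      then show "f x \<le> f z + L * euclid_dist D z x"
        using lip[of z x] x by linarith
    qed
  qed
  have dist_cont: "((\<lambda>x. euclid_dist D x x0) \<longlongrightarrow> 0) (at x0)" for x0 :: "nat \<Rightarrow> real"
  proof -
    have "continuous_on UNIV (\<lambda>x. euclid_dist D x x0)"
      unfolding euclid_dist_def L2_set_def
      by (intro continuous_intros continuous_on_product_coordinates)
    then have "((\<lambda>x. euclid_dist D x x0) \<longlongrightarrow> euclid_dist D x0 x0) (at x0)"
      by (simp add: continuous_on_def)
    then show ?thesis by (simp add: euclid_dist_def L2_set_def)
  qed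
  have "continuous_on UNIV F"
    unfolding continuous_on_def
  proof (intro ballI)
    fix x0 :: "nat \<Rightarrow> real"
    have "((\<lambda>x. F x - F x0) \<longlongrightarrow> 0) (at x0)"
    proof (rule Lim_null_comparison)
      have "norm (F x - F x0) \<le> L * euclid_dist D x x0" for x
        using le[of x x0] le[of x0 x] by (simp add: euclid_dist_commute[of D x0 x])
      then show "\<forall>\<^sub>F x in at x0. norm (F x - F x0) \<le> L * euclid_dist D x x0" by simp
      show "((\<lambda>x. L * euclid_dist D x x0) \<longlongrightarrow> 0) (at x0)"
        using tendsto_mult_right_zero[OF dist_cont] by simp
    qed
    then show "(F \<longlongrightarrow> F x0) (at x0 within UNIV)" by (simp add: LIM_zero_iff)
  qed
  then have Fm: "F \<in> borel_measurable borel" by (rule borel_measurable_continuous_onI)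
  \<comment> \<open>Continuity was proved in the product topology on all of
    \<open>nat \<Rightarrow> real\<close>. Resetting the coordinates from \<open>D\<close> on to
    \<open>undefined\<close> is measurable into that space and fixes every point of
    \<open>RV D\<close>.\<close>
  have ext: "(\<lambda>z i. if i < D then z i else undefined) \<in> measurable (RV D) (borel :: (nat \<Rightarrow> real) measure)"
  proof -
    have "(\<lambda>z i. if i < D then z i else undefined) \<in> measurable (RV D) (\<Pi>\<^sub>M i\<in>UNIV. (borel :: real measure))"
    proof (rule measurable_PiM_single')
      fix i :: nat
      show "(\<lambda>z. if i < D then z i else undefined) \<in> borel_measurable (RV D)"
        by (cases "i < D") auto
    qed auto
    then show ?thesis
      using measurable_cong_sets[OF refl sets_PiM_equal_borel] by blast
  qed
  have "F \<in> borel_measurable (RV D)"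
  proof (rule measurable_cong[THEN iffD2, OF _ measurable_compose[OF ext Fm]])
    fix z assume "z \<in> space (RV D)"
    then have "z = (\<lambda>i. if i < D then z i else undefined)"
      by (auto simp: space_PiM PiE_iff extensional_def fun_eq_iff)
    then show "F z = F (\<lambda>i. if i < D then z i else undefined)" by simp
  qed
  with eq show ?thesis using that by blast
qed

section \<open>History sigma-algebras and the law of the leading columns\<close>

lemma vimage_sets_subset:
  assumes "f \<in> measurable M N"
  shows "sets (vimage_algebra (space M) f N) \<subseteq> sets M"
  using measurable_space[OF assms] measurable_sets[OF assms]
  by (subst sets_vimage_algebra2) (auto simp: Pi_iff)

lemma sets_vimage_algebra_into_space: "S \<in> sets (vimage_algebra Z g N) \<Longrightarrow> S \<subseteq> Z"
  using sets.sets_into_space[of S "vimage_algebra Z g N"] by simp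

context xrego
begin

lemma space_hist [simp]: "space (hist M D d A y p a b c) = space M"
  unfolding hist_def by (intro space_measure_of) (auto dest: sets_vimage_algebra_into_space)

lemma sets_hist:
  "sets (hist M D d A y p a b c) = sigma_sets (space M)
     ((\<Union>i\<in>{1..a}. sets (vimage_algebra (space M) (A i) (RM D (d i)))) \<union>
      (\<Union>i\<in>{1..b}. sets (vimage_algebra (space M) (y i) (RV (d i)))) \<union>
      (\<Union>i\<in>{0..c}. sets (vimage_algebra (space M) (p i) (RV D))))"
  unfolding hist_def by (intro sets_measure_of) (auto dest: sets_vimage_algebra_into_space)

lemma sets_hist_mono:
  assumes "a \<le> a'" "b \<le> b'" "c \<le> c'"
  shows "sets (hist M D d A y p a b c) \<subseteq> sets (hist M D d A y p a' b' c')"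
  unfolding sets_hist using assms
  by (intro sigma_sets_mono' Un_mono UN_mono) auto

lemma subalgebra_hist: "subalgebra M (hist M D d A y p a b c)"
  unfolding subalgebra_def
proof (intro conjI)
  show "sets (hist M D d A y p a b c) \<subseteq> sets M"
    unfolding sets_hist
  proof (rule sets.sigma_sets_subset, intro Un_least UN_least)
    fix i assume "i \<in> {1..a}"
    then show "sets (vimage_algebra (space M) (A i) (RM D (d i))) \<subseteq> sets M"
      by (intro vimage_sets_subset A_measurable) simp
  next
    fix i assume "i \<in> {1..b}"
    then show "sets (vimage_algebra (space M) (y i) (RV (d i))) \<subseteq> sets M"
      by (intro vimage_sets_subset y_measurable) simp
  next
    fix i
    show "sets (vimage_algebra (space M) (p i) (RV D)) \<subseteq> sets M"
      by (intro vimage_sets_subset p_measurable)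
  qed
qed simp

lemma measurable_hist_A:
  assumes "1 \<le> i" "i \<le> a"
  shows "A i \<in> measurable (hist M D d A y p a b c) (RM D (d i))"
proof (rule measurableI)
  fix S assume "S \<in> sets (RM D (d i))"
  then have "A i -` S \<inter> space M \<in> sets (vimage_algebra (space M) (A i) (RM D (d i)))"
    by (rule in_vimage_algebra)
  then show "A i -` S \<inter> space (hist M D d A y p a b c) \<in> sets (hist M D d A y p a b c)"
    unfolding space_hist sets_hist using assms by (intro sigma_sets.Basic) auto
qed (simp add: measurable_space[OF A_measurable[OF assms(1)]])

lemma measurable_hist_p:
  assumes "i \<le> c"
  shows "p i \<in> measurable (hist M D d A y p a b c) (RV D)"
proof (rule measurableI)
  fix S assume "S \<in> sets (RV D)"
  then have "p i -` S \<inter> space M \<in> sets (vimage_algebra (space M) (p i) (RV D))"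
    by (rule in_vimage_algebra)
  then show "p i -` S \<inter> space (hist M D d A y p a b c) \<in> sets (hist M D d A y p a b c)"
    unfolding space_hist sets_hist using assms by (intro sigma_sets.Basic) auto
qed (simp add: measurable_space[OF p_measurable])

text \<open>A subfamily of independent entries is independent, so its joint law is the product of
  the marginals, which are standard normal.\<close>

lemma distr_leading_columns:
  assumes k: "1 \<le> k" and dl: "1 \<le> dl" "dl \<le> d k"
  shows "distr M (RM D dl) (\<lambda>\<omega>. restrict (A k \<omega>) ({..<D} \<times> {..<dl})) = gauss ({..<D} \<times> {..<dl})"
proof -
  let ?I = "{..<D} \<times> {..<dl}"
  have "(0, 0) \<in> ?I" using d_range[OF k] dl by auto
  then have ne: "?I \<noteq> {}" by blast
  have m: "(\<lambda>\<omega>. A k \<omega> ij) \<in> borel_measurable M" if "ij \<in> ?I" for ij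
    using that dl by (intro measurable_compose[OF A_measurable[OF k] measurable_component_singleton]) auto
  have "indep_vars (\<lambda>_. borel) (\<lambda>ij \<omega>. A k \<omega> ij) ?I"
    using A_entries_indep[OF k] by (rule indep_vars_subset) (use dl in auto)
  then have "distr M (RM D dl) (\<lambda>\<omega>. \<lambda>ij\<in>?I. A k \<omega> ij) = (\<Pi>\<^sub>M ij\<in>?I. distr M borel (\<lambda>\<omega>. A k \<omega> ij))"
    using indep_vars_iff_distr_eq_PiM'[where X = "\<lambda>ij \<omega>. A k \<omega> ij", OF ne m] by simp
  also have "\<dots> = gauss ?I"
    unfolding gauss_def
  proof (rule PiM_cong)
    fix ij assume ij: "ij \<in> ?I"
    then have "distributed M lborel (\<lambda>\<omega>. A k \<omega> ij) (\<lambda>t. ennreal (std_normal_density t))"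
      using A_normal[OF k] dl by (cases ij) auto
    then have "distr M lborel (\<lambda>\<omega>. A k \<omega> ij) = density lborel (\<lambda>t. ennreal (std_normal_density t))"
      by (rule distributed_distr_eq_density)
    then show "distr M borel (\<lambda>\<omega>. A k \<omega> ij) = density lborel (\<lambda>t. ennreal (std_normal_density t))"
      by (simp cong: distr_cong)
  qed simp
  finally show ?thesis .
qed

end

section \<open>Probability of success for one process in a fixed dimension\<close>

locale xrego_lipschitz = xrego +
  fixes L \<epsilon> R \<rho>_lb :: real and dl :: nat and xstar :: "nat \<Rightarrow> real"
  assumes lam_less: "lam < \<epsilon>" and L_pos: "L > 0" and dl: "1 \<le> dl" "dl < D"
    and R_gt: "R > (\<epsilon> - lam) / L"
    and lipschitz: "\<And>x z. x \<in> X \<Longrightarrow> z \<in> X \<Longrightarrow> \<bar>f x - f z\<bar> \<le> L * euclid_dist D x z"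
    and rho_pos: "\<rho>_lb > 0"
    and success: "\<And>k. k \<ge> 1 \<Longrightarrow> \<exists>\<rho>\<in>{\<rho>_lb..1}. AE \<omega> in M.
          real_cond_exp M (F_half M D d A y p k)
            (indicat_real (solved M D X f lam d A y p k)) \<omega> \<ge> \<rho>"
    and xstar: "xstar \<in> X" "\<And>x. x \<in> X \<Longrightarrow> f xstar \<le> f x"
    and xstar_ball: "euclid_cball D xstar ((\<epsilon> - lam) / L) \<subseteq> X"
    and p_dist: "\<And>k \<omega>. \<omega> \<in> space M \<Longrightarrow> euclid_dist D (p k \<omega>) xstar \<le> R"
    and d_ge: "\<And>k. k \<ge> 1 \<Longrightarrow> dl \<le> d k"
begin

definition radius :: real where "radius = (\<epsilon> - lam) / L"

definition hit_prob :: real where "hit_prob = hit_bound D dl (radius / R)"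

definition leading :: "nat \<Rightarrow> 'a \<Rightarrow> nat \<times> nat \<Rightarrow> real" where
  "leading k \<omega> = restrict (A k \<omega>) ({..<D} \<times> {..<dl})"

definition offset :: "nat \<Rightarrow> 'a \<Rightarrow> nat \<Rightarrow> real" where
  "offset k \<omega> = (\<lambda>i\<in>{..<D}. p k \<omega> i - xstar i)"

abbreviation "solved_at \<equiv> solved M D X f lam d A y p"

text \<open>Geometrically, the span of the leading columns, translated to \<open>p (k - 1)\<close>,
  enters the open ball of radius \<open>radius\<close> around \<open>xstar\<close>;
  \<open>offset\<close> recentres that ball at the origin.\<close>

definition hits :: "nat \<Rightarrow> 'a set" where
  "hits k = {\<omega> \<in> space M. near_point D dl radius (leading k \<omega>) (offset (k - 1) \<omega>)}"

definition fails :: "nat \<Rightarrow> 'a set" where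
  "fails n = {\<omega> \<in> space M. \<forall>k\<in>{1..n}. \<omega> \<notin> hits k \<inter> solved_at k}"

lemma radius: "0 < radius" "radius < R"
  using lam_less L_pos R_gt by (auto simp: radius_def)

lemma hit_prob_pos: "hit_prob > 0"
  unfolding hit_prob_def using dl radius by (intro hit_bound_pos) auto

lemma fstar_eq: "fstar X f = f xstar"
  unfolding fstar_def using xstar by (intro cInf_eq_minimum) auto

lemma fails_Suc: "fails (Suc n) = fails n - hits (Suc n) \<inter> solved_at (Suc n)"
  by (auto simp: fails_def atLeastAtMostSuc_conv)

lemma leading_measurable:
  assumes "1 \<le> k" "k \<le> a"
  shows "leading k \<in> measurable (hist M D d A y p a b c) (RM D dl)"
  unfolding leading_def
  by (intro measurable_compose[OF measurable_hist_A[OF assms] measurable_restrict_subset])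
    (use d_ge[OF assms(1)] in auto)

lemma offset_measurable:
  assumes "k \<le> c"
  shows "offset k \<in> measurable (hist M D d A y p a b c) (RV D)"
  unfolding offset_def
proof (rule measurable_restrict)
  fix i assume "i \<in> {..<D}"
  then have "(\<lambda>\<omega>. p k \<omega> i) \<in> borel_measurable (hist M D d A y p a b c)"
    by (intro measurable_compose[OF measurable_hist_p[OF assms] measurable_component_singleton])
  then show "(\<lambda>\<omega>. p k \<omega> i - xstar i) \<in> borel_measurable (hist M D d A y p a b c)"
    by simp
qed

text \<open>The event depends on \<open>A k\<close> and \<open>p (k - 1)\<close> only and is decided
  before the solver answers, which later permits conditioning on \<open>F_half\<close>.\<close>

lemma hits_half:
  assumes "1 \<le> k"
  shows "hits k \<in> sets (F_half M D d A y p k)"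
proof -
  have "Measurable.pred (F_half M D d A y p k) (\<lambda>\<omega>. near_point D dl radius (leading k \<omega>) (offset (k - 1) \<omega>))"
    unfolding F_half_def using assms
    by (intro measurable_near_point leading_measurable offset_measurable) auto
  then show ?thesis by (simp add: pred_def hits_def F_half_def)
qed

lemma fails_full: "fails n \<in> sets (F_full M D d A y p n)"
proof (induction n)
  case 0
  have "fails 0 = space (F_full M D d A y p 0)" by (simp add: fails_def F_full_def)
  then show ?case by (metis sets.top)
next
  case (Suc n)
  have "fails n \<in> sets (F_full M D d A y p (Suc n))"
    using Suc sets_hist_mono[of n "Suc n" n "Suc n" n "Suc n"] by (auto simp: F_full_def)
  moreover have "hits (Suc n) \<in> sets (F_full M D d A y p (Suc n))"
    using hits_half[of "Suc n"] sets_hist_mono[of "Suc n" "Suc n" n "Suc n" n "Suc n"]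
    by (auto simp: F_half_def F_full_def)
  moreover have "solved_at (Suc n) \<in> sets (F_full M D d A y p (Suc n))"
    by (rule solved_measurable) simp
  ultimately show ?case unfolding fails_Suc by auto
qed

lemma sets_events [measurable]:
  shows "fails n \<in> sets M" "k \<ge> 1 \<Longrightarrow> hits k \<in> sets M" "k \<ge> 1 \<Longrightarrow> solved_at k \<in> sets M"
  using fails_full[of n] hits_half[of k] solved_measurable[of k] subalgebra_hist
  unfolding F_full_def F_half_def subalgebra_def by blast+

lemma fails_half: "fails n \<in> sets (F_half M D d A y p (Suc n))"
  using fails_full[of n] sets_hist_mono[of n "Suc n" n n n n] by (auto simp: F_full_def F_half_def)

lemma sq_norm_offset: "\<omega> \<in> space M \<Longrightarrow> sq_norm D (offset k \<omega>) \<le> R\<^sup>2"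
proof -
  assume "\<omega> \<in> space M"
  then have "(euclid_dist D (p k \<omega>) xstar)\<^sup>2 \<le> R\<^sup>2" using p_dist by (intro power_mono) auto
  then show ?thesis
    by (simp add: euclid_dist_def L2_set_def sq_norm_def offset_def sum_nonneg)
qed

lemma hit_prob_le_1: "hit_prob \<le> 1"
proof -
  obtain \<omega> where \<omega>: "\<omega> \<in> space M" using not_empty by auto
  have "offset 0 \<omega> \<in> space (RV D)" by (simp add: offset_def space_PiM)
  from near_point_prob[OF dl radius this sq_norm_offset[OF \<omega>]]
  have "ennreal hit_prob \<le> 1"
    unfolding hit_prob_def
    by (rule order_trans) (rule prob_space.emeasure_le_1[OF prob_space_gauss])
  then show ?thesis using hit_prob_pos by simp
qed

text \<open>The new matrix is independent of the past, so Fubini lets us fix the past and apply the bound for one draw.\<close>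

lemma prob_hit_given_past:
  "hit_prob * prob (fails n) \<le> prob (fails n \<inter> hits (Suc n))"
proof -
  let ?T = "RV D \<Otimes>\<^sub>M count_space (UNIV :: bool set)"
  \<comment> \<open>The past matters only through the offset and through whether all earlier steps
    failed; packing both into one random element gives a single product law.\<close>
  let ?Y = "\<lambda>\<omega>. (offset n \<omega>, \<omega> \<in> fails n)"
  let ?F = "F_full M D d A y p n"
  have YF: "?Y \<in> measurable ?F ?T"
  proof (rule measurable_Pair)
    show "offset n \<in> measurable ?F (RV D)"
      unfolding F_full_def by (rule offset_measurable) simp
    show "(\<lambda>\<omega>. \<omega> \<in> fails n) \<in> measurable ?F (count_space UNIV)"
      using fails_full[of n] by measurable
  qed
  have sub: "subalgebra M ?F" unfolding F_full_def by (rule subalgebra_hist)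
  have Ym [measurable]: "?Y \<in> measurable M ?T" using measurable_from_subalg[OF sub YF] .
  have Xm [measurable]: "leading (Suc n) \<in> measurable M (RM D dl)"
    using measurable_from_subalg[OF subalgebra_hist leading_measurable[of "Suc n" "Suc n" 0 0]] by simp
  have indep: "indep_set (sets (vimage_algebra (space M) (A (Suc n)) (RM D (d (Suc n))))) (sets ?F)"
    using A_indep_past[of "Suc n"] by simp
  have XA: "leading (Suc n) \<in> measurable (vimage_algebra (space M) (A (Suc n)) (RM D (d (Suc n)))) (RM D dl)"
    unfolding leading_def
  proof (rule measurable_compose[OF measurable_vimage_algebra1 measurable_restrict_subset])
    show "A (Suc n) \<in> space M \<rightarrow> space (RM D (d (Suc n)))"
      using measurable_space[OF A_measurable[of "Suc n"]] by auto
    show "{..<D} \<times> {..<dl} \<subseteq> {..<D} \<times> {..<d (Suc n)}"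
      using d_ge[of "Suc n"] by auto
  qed
  \<comment> \<open>Independence of the new matrix from the past, checked on rectangles.\<close>
  have joint: "distr M (RM D dl) (leading (Suc n)) \<Otimes>\<^sub>M distr M ?T ?Y =
      distr M (RM D dl \<Otimes>\<^sub>M ?T) (\<lambda>\<omega>. (leading (Suc n) \<omega>, ?Y \<omega>))"
  proof (rule pair_measure_eqI)
    show "sigma_finite_measure (distr M (RM D dl) (leading (Suc n)))"
      by (intro prob_space_imp_sigma_finite prob_space_distr Xm)
    show "sigma_finite_measure (distr M ?T ?Y)"
      by (intro prob_space_imp_sigma_finite prob_space_distr Ym)
    show "sets (distr M (RM D dl) (leading (Suc n)) \<Otimes>\<^sub>M distr M ?T ?Y) =
        sets (distr M (RM D dl \<Otimes>\<^sub>M ?T) (\<lambda>\<omega>. (leading (Suc n) \<omega>, ?Y \<omega>)))"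
      unfolding sets_distr by (intro sets_pair_measure_cong) simp_all
  next
    fix B C assume "B \<in> sets (distr M (RM D dl) (leading (Suc n)))" "C \<in> sets (distr M ?T ?Y)"
    then have B: "B \<in> sets (RM D dl)" and C: "C \<in> sets ?T" by simp_all
    have "prob ((leading (Suc n) -` B \<inter> space M) \<inter> (?Y -` C \<inter> space M)) =
        prob (leading (Suc n) -` B \<inter> space M) * prob (?Y -` C \<inter> space M)"
      using measurable_sets[OF XA B] measurable_sets[OF YF C]
      by (intro indep_setD[OF indep]) (simp_all add: F_full_def)
    moreover have "(\<lambda>\<omega>. (leading (Suc n) \<omega>, ?Y \<omega>)) -` (B \<times> C) \<inter> space M =
        (leading (Suc n) -` B \<inter> space M) \<inter> (?Y -` C \<inter> space M)" by auto
    ultimately show "emeasure (distr M (RM D dl) (leading (Suc n))) B * emeasure (distr M ?T ?Y) C =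
        emeasure (distr M (RM D dl \<Otimes>\<^sub>M ?T) (\<lambda>\<omega>. (leading (Suc n) \<omega>, ?Y \<omega>))) (B \<times> C)"
      using B C
      by (simp add: emeasure_distr emeasure_eq_measure ennreal_mult[symmetric] del: vimage_Times)
  qed
  let ?G = "gauss ({..<D} \<times> {..<dl})" and ?H = "distr M ?T ?Y"
  have law: "distr M (RM D dl) (leading (Suc n)) = ?G"
    using distr_leading_columns[of "Suc n" dl] dl d_ge[of "Suc n"] by (simp add: leading_def[abs_def])
  interpret G: prob_space ?G by (rule prob_space_gauss)
  interpret H: prob_space ?H by (rule prob_space_distr[OF Ym])
  interpret P: pair_sigma_finite ?G ?H ..
  let ?E = "{z \<in> space (RM D dl \<Otimes>\<^sub>M ?T). snd (snd z) \<and> near_point D dl radius (fst z) (fst (snd z))}"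
  have [measurable]: "?E \<in> sets (RM D dl \<Otimes>\<^sub>M ?T)" by measurable
  have sE: "sets (?G \<Otimes>\<^sub>M ?H) = sets (RM D dl \<Otimes>\<^sub>M ?T)"
    by (intro sets_pair_measure_cong) simp_all
  have "emeasure M (fails n \<inter> hits (Suc n)) =
      emeasure (distr M (RM D dl \<Otimes>\<^sub>M ?T) (\<lambda>\<omega>. (leading (Suc n) \<omega>, ?Y \<omega>))) ?E"
  proof (subst emeasure_distr)
    show "emeasure M (fails n \<inter> hits (Suc n)) =
        emeasure M ((\<lambda>\<omega>. (leading (Suc n) \<omega>, ?Y \<omega>)) -` ?E \<inter> space M)"
      using measurable_space[OF Xm] measurable_space[OF Ym]
      by (intro arg_cong[where f = "emeasure M"]) (auto simp: hits_def fails_def space_pair_measure)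
  qed measurable
  also have "\<dots> = emeasure (?G \<Otimes>\<^sub>M ?H) ?E"
    unfolding joint[symmetric] law ..
  also have "\<dots> = (\<integral>\<^sup>+z. emeasure ?G ((\<lambda>B. (B, z)) -` ?E) \<partial>?H)"
    by (intro P.emeasure_pair_measure_alt2) (simp add: sE)
  also have "\<dots> = (\<integral>\<^sup>+\<omega>. emeasure ?G ((\<lambda>B. (B, ?Y \<omega>)) -` ?E) \<partial>M)"
  proof (rule nn_integral_distr[OF Ym])
    show "(\<lambda>z. emeasure ?G ((\<lambda>B. (B, z)) -` ?E)) \<in> borel_measurable ?H"
      by (intro P.measurable_emeasure_Pair2) (simp add: sE)
  qed
  also have "\<dots> \<ge> (\<integral>\<^sup>+\<omega>. ennreal hit_prob * indicator (fails n) \<omega> \<partial>M)"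
  proof (rule nn_integral_mono)
    fix \<omega> assume \<omega>: "\<omega> \<in> space M"
    show "ennreal hit_prob * indicator (fails n) \<omega> \<le> emeasure ?G ((\<lambda>B. (B, ?Y \<omega>)) -` ?E)"
    proof (cases "\<omega> \<in> fails n")
      case True
      have o: "offset n \<omega> \<in> space (RV D)" by (simp add: offset_def space_PiM)
      have "(\<lambda>B. (B, ?Y \<omega>)) -` ?E = {B \<in> space ?G. near_point D dl radius B (offset n \<omega>)}"
        using True o by (auto simp: space_pair_measure space_PiM)
      then show ?thesis
        using near_point_prob[OF dl radius o sq_norm_offset[OF \<omega>]] True by (simp add: hit_prob_def)
    qed simp
  qed
  also have "(\<integral>\<^sup>+\<omega>. ennreal hit_prob * indicator (fails n) \<omega> \<partial>M) = ennreal hit_prob * emeasure M (fails n)"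
    by (intro nn_integral_cmult_indicator) simp
  finally show ?thesis
    using hit_prob_pos by (simp add: emeasure_eq_measure ennreal_mult[symmetric])
qed

text \<open>The event of having failed so far and hitting now belongs to \<open>F_half\<close>, so
  integrating the conditional success probability over it gives the probability of the
  intersection.\<close>

lemma prob_solved_given_hit:
  "\<rho>_lb * prob (fails n \<inter> hits (Suc n)) \<le> prob (fails n \<inter> hits (Suc n) \<inter> solved_at (Suc n))"
proof -
  let ?F = "F_half M D d A y p (Suc n)" and ?B = "fails n \<inter> hits (Suc n)" and ?S = "solved_at (Suc n)"
  have sub: "subalgebra M ?F" unfolding F_half_def by (rule subalgebra_hist)
  interpret F: finite_measure_subalgebra M ?F by unfold_locales (rule sub)
  have B: "?B \<in> sets ?F" using fails_half[of n] hits_half[of "Suc n"] by auto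
  have [measurable]: "?B \<in> sets M" "?S \<in> sets M" using sets_events by auto
  obtain \<rho> where \<rho>: "\<rho>_lb \<le> \<rho>" "AE \<omega> in M. real_cond_exp M ?F (indicat_real ?S) \<omega> \<ge> \<rho>"
    using success[of "Suc n"] by auto
  have int: "integrable M (indicat_real ?S)" by (simp add: emeasure_eq_measure)
  have "\<rho>_lb * prob ?B = (LINT \<omega>|M. \<rho>_lb * indicat_real ?B \<omega>)"
    by simp
  also have "\<dots> \<le> (LINT \<omega>|M. indicat_real ?B \<omega> * real_cond_exp M ?F (indicat_real ?S) \<omega>)"
  proof (rule integral_mono_AE)
    show "AE \<omega> in M. \<rho>_lb * indicat_real ?B \<omega> \<le> indicat_real ?B \<omega> * real_cond_exp M ?F (indicat_real ?S) \<omega>"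
      using \<rho>(2) by eventually_elim (use \<rho>(1) in \<open>auto simp: indicator_def\<close>)
    show "integrable M (\<lambda>\<omega>. indicat_real ?B \<omega> * real_cond_exp M ?F (indicat_real ?S) \<omega>)"
      using integrable_mult_indicator[OF \<open>?B \<in> sets M\<close> F.real_cond_exp_int(1)[OF int]] by simp
  qed (simp add: emeasure_eq_measure)
  also have "\<dots> = (LINT \<omega>|M. indicat_real ?B \<omega> * indicat_real ?S \<omega>)"
    using F.real_cond_exp_intA[OF int B] by (simp add: set_lebesgue_integral_def)
  also have "\<dots> = (LINT \<omega>|M. indicat_real (?B \<inter> ?S) \<omega>)"
    by (simp add: indicator_inter_arith)
  also have "\<dots> = prob (?B \<inter> ?S)" by simp
  finally show ?thesis .
qed

lemma rho_le_1: "\<rho>_lb \<le> 1"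
  using success[of 1] by auto

text \<open>Chaining the two one-step bounds, each further step removes at least the fraction
  \<open>\<rho>_lb * hit_prob\<close> of the remaining failure probability.\<close>

lemma prob_fails_le: "prob (fails n) \<le> (1 - \<rho>_lb * hit_prob) ^ n"
proof (induction n)
  case 0 show ?case by simp
next
  case (Suc n)
  let ?Z = "fails n \<inter> hits (Suc n) \<inter> solved_at (Suc n)"
  have [measurable]: "?Z \<in> sets M" using sets_events by auto
  have "fails (Suc n) = fails n - ?Z" unfolding fails_Suc by auto
  then have "prob (fails (Suc n)) = prob (fails n) - prob ?Z"
    using finite_measure_Diff[of "fails n" ?Z] by auto
  moreover have "\<rho>_lb * (hit_prob * prob (fails n)) \<le> \<rho>_lb * prob (fails n \<inter> hits (Suc n))"
    using prob_hit_given_past rho_pos by (intro mult_left_mono) auto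
  ultimately have "prob (fails (Suc n)) \<le> (1 - \<rho>_lb * hit_prob) * prob (fails n)"
    using prob_solved_given_hit[of n] by (simp add: algebra_simps)
  also have "\<dots> \<le> (1 - \<rho>_lb * hit_prob) * (1 - \<rho>_lb * hit_prob) ^ n"
  proof (intro mult_left_mono Suc)
    show "0 \<le> 1 - \<rho>_lb * hit_prob"
      using mult_mono[OF rho_le_1 hit_prob_le_1] hit_prob_pos by simp
  qed
  finally show ?case by simp
qed

lemma xopt_in_X:
  assumes "1 \<le> k" "\<omega> \<in> space M"
  shows "xopt k \<omega> \<in> X"
  using xopt_arg_min[OF assms] y_feasible[OF _ assms(2)] by (auto simp: is_arg_min_def)

lemma f_xopt_le:
  assumes "1 \<le> i" "i \<le> k" "\<omega> \<in> space M"
  shows "f (xopt k \<omega>) \<le> f (iterate D d A y p i \<omega>)"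
  using xopt_arg_min[of k \<omega>] assms by (auto simp: is_arg_min_def not_less)

text \<open>A hit yields a point of the affine subspace inside the ball, hence feasible, with value
  at most \<open>L * radius = \<epsilon> - lam\<close> above the minimum; an accurate solve loses at
  most a further \<open>lam\<close>.\<close>

lemma iterate_eps_min:
  assumes k: "1 \<le> k" and \<omega>: "\<omega> \<in> hits k" "\<omega> \<in> solved_at k"
  shows "f (iterate D d A y p k \<omega>) \<le> fstar X f + \<epsilon>"
proof -
  have sp: "\<omega> \<in> space M" using \<omega> by (simp add: hits_def)
  obtain z where z: "z \<in> PiE {..<dl} (\<lambda>_. \<rat>)"
    "sq_norm D (affine_emb D dl (leading k \<omega>) z (offset (k - 1) \<omega>)) < radius\<^sup>2"
    using \<omega> by (auto simp: hits_def near_point_def)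
  \<comment> \<open>Zero coefficients switch off the columns beyond the first
    \<open>dl\<close>.\<close>
  define u where "u = (\<lambda>j\<in>{..<d k}. if j < dl then z j else 0)"
  let ?x = "affine_emb D (d k) (A k \<omega>) u (p (k - 1) \<omega>)"
  have dk: "dl \<le> d k" by (rule d_ge[OF k])
  have "?x i - xstar i = affine_emb D dl (leading k \<omega>) z (offset (k - 1) \<omega>) i" if "i < D" for i
  proof -
    have "(\<Sum>j<d k. A k \<omega> (i, j) * u j) = (\<Sum>j<dl. leading k \<omega> (i, j) * z j)"
      using dk that by (intro sum.mono_neutral_cong_right) (auto simp: u_def leading_def)
    then show ?thesis using that by (simp add: affine_emb_def offset_def)
  qed
  then have "(\<Sum>i<D. (?x i - xstar i)\<^sup>2) < radius\<^sup>2"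
    using z(2) by (simp add: sq_norm_def)
  then have "sqrt (\<Sum>i<D. (?x i - xstar i)\<^sup>2) < radius"
    using radius(1) by (intro real_less_lsqrt) (auto simp: sum_nonneg)
  then have dist: "euclid_dist D ?x xstar \<le> radius"
    by (simp add: euclid_dist_def L2_set_def)
  moreover have "?x \<in> space (RV D)" by (simp add: affine_emb_def space_PiM)
  ultimately have xX: "?x \<in> X"
    using xstar_ball by (auto simp: euclid_cball_def radius_def euclid_dist_commute[of D xstar])
  have "f ?x \<le> f xstar + L * euclid_dist D ?x xstar"
    using lipschitz[OF xX xstar(1)] by linarith
  also have "L * euclid_dist D ?x xstar \<le> L * radius"
    using dist L_pos by (intro mult_left_mono) auto
  also have "L * radius = \<epsilon> - lam" using L_pos by (simp add: radius_def)
  finally have fx: "f ?x \<le> fstar X f + \<epsilon> - lam" by (simp add: fstar_eq)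
  have "reduced_min D X f (d k) (A k \<omega>) (p (k - 1) \<omega>) \<le> f ?x"
    unfolding reduced_min_def
  proof (rule cINF_lower)
    show "bdd_below ((\<lambda>y. f (affine_emb D (d k) (A k \<omega>) y (p (k - 1) \<omega>))) `
        {y \<in> space (RV (d k)). affine_emb D (d k) (A k \<omega>) y (p (k - 1) \<omega>) \<in> X})"
      by (rule bdd_belowI2[of _ "f xstar"]) (use xstar(2) in auto)
    show "u \<in> {y \<in> space (RV (d k)). affine_emb D (d k) (A k \<omega>) y (p (k - 1) \<omega>) \<in> X}"
      using xX by (auto simp: u_def space_PiM)
  qed
  then show ?thesis using \<omega>(2) fx by (auto simp: solved_def)
qed

text \<open>The best value so far never increases, so a single success persists.\<close>

lemma xopt_eps_min:
  assumes "\<omega> \<in> space M" "\<omega> \<notin> fails n" "n \<le> k"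
  shows "xopt k \<omega> \<in> eps_min X f \<epsilon>"
proof -
  obtain i where i: "1 \<le> i" "i \<le> n" "\<omega> \<in> hits i" "\<omega> \<in> solved_at i"
    using assms by (auto simp: fails_def)
  then have "f (xopt k \<omega>) \<le> fstar X f + \<epsilon>"
    using iterate_eps_min[of i \<omega>] f_xopt_le[of i k \<omega>] assms by simp
  then show ?thesis using xopt_in_X[of k \<omega>] i assms by (auto simp: eps_min_def)
qed

text \<open>Measurability comes from the iterates, not from \<open>xopt\<close>: the best value is
  below the threshold exactly when that of some iterate is.\<close>

lemma eps_min_event:
  assumes k: "1 \<le> k"
  shows "{\<omega> \<in> space M. xopt k \<omega> \<in> eps_min X f \<epsilon>} = {\<omega> \<in> space M. f (xopt k \<omega>) \<le> fstar X f + \<epsilon>}"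
    and "{\<omega> \<in> space M. xopt k \<omega> \<in> eps_min X f \<epsilon>} \<in> sets M"
proof -
  show eq: "{\<omega> \<in> space M. xopt k \<omega> \<in> eps_min X f \<epsilon>} = {\<omega> \<in> space M. f (xopt k \<omega>) \<le> fstar X f + \<epsilon>}"
    using xopt_in_X[OF k] by (auto simp: eps_min_def)
  have X: "X \<noteq> {}" using xstar by auto
  obtain F where F: "F \<in> borel_measurable (RV D)" "\<And>x. x \<in> X \<Longrightarrow> F x = f x"
    using lipschitz_measurable_extension[OF X less_imp_le[OF L_pos] lipschitz] by blast
  have it: "iterate D d A y p i \<in> measurable M (RV D)" if "1 \<le> i" for i
    unfolding iterate_def[abs_def] affine_emb_def
  proof (rule measurable_restrict)
    fix j assume j: "j \<in> {..<D}"
    have mp: "(\<lambda>\<omega>. p (i - 1) \<omega> j) \<in> borel_measurable M"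
      using j by (intro measurable_compose[OF p_measurable measurable_component_singleton])
    have mA: "(\<lambda>\<omega>. A i \<omega> (j, l)) \<in> borel_measurable M" if "l < d i" for l
      using j that by (intro measurable_compose[OF A_measurable[OF \<open>1 \<le> i\<close>] measurable_component_singleton]) auto
    have my: "(\<lambda>\<omega>. y i \<omega> l) \<in> borel_measurable M" if "l < d i" for l
      using that by (intro measurable_compose[OF y_measurable[OF \<open>1 \<le> i\<close>] measurable_component_singleton]) auto
    show "(\<lambda>\<omega>. (\<Sum>l<d i. A i \<omega> (j, l) * y i \<omega> l) + p (i - 1) \<omega> j) \<in> borel_measurable M"
      by (intro borel_measurable_add borel_measurable_sum borel_measurable_times mp mA my) auto
  qed
  have "{\<omega> \<in> space M. f (xopt k \<omega>) \<le> fstar X f + \<epsilon>} =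
      {\<omega> \<in> space M. \<exists>i\<in>{1..k}. F (iterate D d A y p i \<omega>) \<le> fstar X f + \<epsilon>}"
  proof (intro Collect_cong conj_cong refl)
    fix \<omega> assume \<omega>: "\<omega> \<in> space M"
    have Ff: "F (iterate D d A y p i \<omega>) = f (iterate D d A y p i \<omega>)" if "1 \<le> i" for i
      using F(2) y_feasible[OF that \<omega>] by simp
    obtain i where "i \<in> {1..k}" "xopt k \<omega> = iterate D d A y p i \<omega>"
      using xopt_arg_min[OF k \<omega>] by (auto simp: is_arg_min_def)
    moreover have "f (xopt k \<omega>) \<le> f (iterate D d A y p i \<omega>)" if "i \<in> {1..k}" for i
      using f_xopt_le[of i k \<omega>] that \<omega> by simp
    ultimately show "f (xopt k \<omega>) \<le> fstar X f + \<epsilon> \<longleftrightarrow>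
        (\<exists>i\<in>{1..k}. F (iterate D d A y p i \<omega>) \<le> fstar X f + \<epsilon>)"
      using Ff by (metis atLeastAtMost_iff order_trans)
  qed
  moreover have "\<dots> \<in> sets M"
  proof (rule sets.sets_Collect_countable_Ex')
    fix i assume "i \<in> {1..k}"
    then have [measurable]: "(\<lambda>\<omega>. F (iterate D d A y p i \<omega>)) \<in> borel_measurable M"
      using measurable_compose[OF it F(1)] by simp
    show "{\<omega> \<in> space M. F (iterate D d A y p i \<omega>) \<le> fstar X f + \<epsilon>} \<in> sets M" by measurable
  qed simp
  ultimately show "{\<omega> \<in> space M. xopt k \<omega> \<in> eps_min X f \<epsilon>} \<in> sets M"
    unfolding eq by simp
qed

lemma prob_eps_min_ge:
  assumes "1 \<le> k"
  shows "1 - (1 - \<rho>_lb * hit_prob) ^ k \<le> prob {\<omega> \<in> space M. xopt k \<omega> \<in> eps_min X f \<epsilon>}"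
proof -
  have "1 - (1 - \<rho>_lb * hit_prob) ^ k \<le> 1 - prob (fails k)"
    using prob_fails_le[of k] by simp
  also have "\<dots> = prob (space M - fails k)"
    by (rule prob_compl[symmetric]) simp
  also have "\<dots> \<le> prob {\<omega> \<in> space M. xopt k \<omega> \<in> eps_min X f \<epsilon>}"
    using xopt_eps_min[of _ k k] eps_min_event(2)[OF assms] by (intro finite_measure_mono) auto
  finally show ?thesis .
qed

lemma rate: "0 < \<rho>_lb * hit_prob" "\<rho>_lb * hit_prob \<le> 1"
  using mult_mono[OF rho_le_1 hit_prob_le_1] hit_prob_pos rho_pos by auto

lemma rate_power_tendsto_0: "(\<lambda>n. (1 - \<rho>_lb * hit_prob) ^ n) \<longlonglongrightarrow> 0"
  using rate by (intro LIMSEQ_power_zero) auto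

text \<open>Failing forever has probability below every power of a number in [0, 1), hence zero;
  outside this null set the first success settles all later indices.\<close>

lemma AE_eps_min: "AE \<omega> in M. \<forall>\<^sub>F k in sequentially. xopt k \<omega> \<in> eps_min X f \<epsilon>"
proof -
  let ?N = "\<Inter>n. fails n"
  have N: "?N \<in> sets M" by (intro sets.countable_INT) auto
  have "prob ?N \<le> (1 - \<rho>_lb * hit_prob) ^ n" for n
    by (rule order_trans[OF finite_measure_mono prob_fails_le]) auto
  then have "prob ?N \<le> 0"
    by (intro LIMSEQ_le_const[OF rate_power_tendsto_0]) auto
  then have "emeasure M ?N = 0" by (simp add: emeasure_eq_measure measure_le_0_iff)
  then have "AE \<omega> in M. \<omega> \<notin> ?N" using N by (intro AE_not_in) (auto simp: null_sets_def)
  moreover have "AE \<omega> in M. \<omega> \<in> space M" by (rule AE_space)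
  ultimately show ?thesis
  proof eventually_elim
    case (elim \<omega>)
    then obtain n where "\<omega> \<notin> fails n" by auto
    then show ?case
      using xopt_eps_min elim(2) by (auto simp: eventually_sequentially)
  qed
qed

lemma prob_eps_min_tendsto:
  "(\<lambda>k. prob {\<omega> \<in> space M. xopt k \<omega> \<in> eps_min X f \<epsilon>}) \<longlonglongrightarrow> 1"
proof (rule real_tendsto_sandwich)
  show "\<forall>\<^sub>F k in sequentially. 1 - (1 - \<rho>_lb * hit_prob) ^ k \<le> prob {\<omega> \<in> space M. xopt k \<omega> \<in> eps_min X f \<epsilon>}"
    using eventually_ge_at_top[of 1] by eventually_elim (rule prob_eps_min_ge)
  show "(\<lambda>k. 1 - (1 - \<rho>_lb * hit_prob) ^ k) \<longlonglongrightarrow> 1"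
    using tendsto_diff[OF tendsto_const[of 1] rate_power_tendsto_0] by simp
qed auto

text \<open>From \<open>1 - x \<le> exp (- x)\<close> the failure probability is at most
  \<open>exp (- \<rho>_lb * hit_prob * k)\<close>; the threshold on \<open>k\<close> is where this
  drops to \<open>1 - \<xi>\<close>.\<close>

lemma prob_eps_min_large:
  assumes \<xi>: "0 < \<xi>" "\<xi> < 1" and k: "1 \<le> k" "real k \<ge> \<bar>ln (1 - \<xi>)\<bar> / \<rho>_lb * (1 / hit_prob)"
  shows "\<xi> \<le> prob {\<omega> \<in> space M. xopt k \<omega> \<in> eps_min X f \<epsilon>}"
proof -
  have "\<bar>ln (1 - \<xi>)\<bar> \<le> (\<rho>_lb * hit_prob) * real k"
    using k(2) rho_pos hit_prob_pos by (simp add: field_simps)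
  moreover have "\<bar>ln (1 - \<xi>)\<bar> = - ln (1 - \<xi>)" using \<xi> by simp
  ultimately have 1: "- (\<rho>_lb * hit_prob) * real k \<le> ln (1 - \<xi>)" by simp
  have "(1 - \<rho>_lb * hit_prob) ^ k \<le> exp (- (\<rho>_lb * hit_prob)) ^ k"
    using rate exp_ge_add_one_self[of "- (\<rho>_lb * hit_prob)"] by (intro power_mono) auto
  also have "\<dots> = exp (- (\<rho>_lb * hit_prob) * real k)"
    by (simp flip: exp_of_nat_mult add: mult.commute)
  also have "\<dots> \<le> exp (ln (1 - \<xi>))" using 1 by simp
  also have "\<dots> = 1 - \<xi>" using \<xi> by simp
  finally show ?thesis using prob_eps_min_ge[OF k(1)] by linarith
qed

end

section \<open>Asymptotics\<close>

text \<open>Log-convexity at \<open>x + 1\<close>, the midpoint of \<open>x + 1 / 2\<close> and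
  \<open>x + 3 / 2\<close>, followed by the functional equation. The crude bound
  \<open>x + 1 / 2 \<le> 2 * x\<close> uses \<open>x \<ge> 1 / 2\<close> and costs only a
  constant.\<close>

lemma Gamma_half_step:
  fixes x :: real
  assumes "x \<ge> 1 / 2"
  shows "sqrt (x / 2) * Gamma x \<le> Gamma (x + 1 / 2)"
proof -
  have pos: "Gamma x > 0" "Gamma (x + 1 / 2) > 0" "Gamma (x + 1) > 0" "Gamma (x + 3 / 2) > 0"
    using assms by (auto intro!: Gamma_real_pos)
  have mid: "(1 - 1 / 2) *\<^sub>R (x + 1 / 2) + (1 / 2) *\<^sub>R (x + 3 / 2) = x + 1"
    by (simp add: algebra_simps)
  have "(ln \<circ> Gamma) ((1 - 1 / 2) *\<^sub>R (x + 1 / 2) + (1 / 2) *\<^sub>R (x + 3 / 2)) \<le>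
      (1 - 1 / 2) * (ln \<circ> Gamma) (x + 1 / 2) + (1 / 2) * (ln \<circ> Gamma) (x + 3 / 2)"
    using assms by (intro convex_onD[OF log_convex_Gamma_real]) auto
  then have "2 * ln (Gamma (x + 1)) \<le> ln (Gamma (x + 1 / 2)) + ln (Gamma (x + 3 / 2))"
    unfolding mid by simp
  then have "ln ((Gamma (x + 1))\<^sup>2) \<le> ln (Gamma (x + 1 / 2) * Gamma (x + 3 / 2))"
    using pos by (simp add: ln_mult ln_realpow)
  then have "(Gamma (x + 1))\<^sup>2 \<le> Gamma (x + 1 / 2) * Gamma (x + 3 / 2)"
    using pos by simp
  also have "Gamma (x + 3 / 2) = (x + 1 / 2) * Gamma (x + 1 / 2)"
    using Gamma_plus1[of "x + 1 / 2"] assms by (simp add: add.assoc nonpos_Ints_def)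
  also have "Gamma (x + 1 / 2) * ((x + 1 / 2) * Gamma (x + 1 / 2)) \<le> (2 * x) * (Gamma (x + 1 / 2))\<^sup>2"
    using assms pos by (simp add: power2_eq_square mult.left_commute mult_right_mono)
  also have "Gamma (x + 1) = x * Gamma x"
    using Gamma_plus1[of x] assms by (simp add: nonpos_Ints_def)
  finally have le: "(x * Gamma x)\<^sup>2 \<le> (2 * x) * (Gamma (x + 1 / 2))\<^sup>2" .
  have "(sqrt (x / 2) * Gamma x)\<^sup>2 = (x * Gamma x)\<^sup>2 / (2 * x)"
  proof -
    have "(sqrt (x / 2))\<^sup>2 = x / 2" using assms by simp
    then show ?thesis using assms by (simp add: power_mult_distrib power2_eq_square[of x])
  qed
  also have "\<dots> \<le> (Gamma (x + 1 / 2))\<^sup>2"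
    using le assms by (simp add: divide_le_eq mult.commute)
  finally show ?thesis by (rule power2_le_imp_le) (use pos in simp)
qed

lemma Gamma_add_half_ge:
  fixes x :: real
  assumes "x \<ge> 1 / 2"
  shows "sqrt (x / 2) ^ d * Gamma x \<le> Gamma (x + real d / 2)"
proof (induction d)
  case 0 show ?case by simp
next
  case (Suc d)
  have "sqrt (x / 2) ^ Suc d * Gamma x = sqrt (x / 2) * (sqrt (x / 2) ^ d * Gamma x)" by simp
  also have "\<dots> \<le> sqrt ((x + real d / 2) / 2) * Gamma (x + real d / 2)"
    using Suc assms Gamma_real_pos[of x] by (intro mult_mono) auto
  also have "\<dots> \<le> Gamma (x + real d / 2 + 1 / 2)"
    using assms by (intro Gamma_half_step) auto
  also have "x + real d / 2 + 1 / 2 = x + real (Suc d) / 2" by (simp add: add_divide_distrib)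
  finally show ?case .
qed

text \<open>The ratio is a power of \<open>sqrt pi\<close> times a quotient of Gamma values whose
  arguments differ by \<open>d\<close> half steps. Since \<open>2 * d \<le> D\<close>, each half
  step gains at least \<open>sqrt (D / 8)\<close>.\<close>

lemma unit_ball_vol_ratio_le:
  fixes D d :: nat
  assumes "2 * d \<le> D" "0 < D"
  shows "unit_ball_vol D / unit_ball_vol (D - d) \<le> sqrt (8 * pi) ^ d / sqrt D ^ d"
proof -
  define x where "x = real (D - d) / 2 + 1"
  have x: "x \<ge> 1 / 2" "x \<ge> real D / 4" "x + real d / 2 = real D / 2 + 1"
    using assms by (auto simp: x_def of_nat_diff field_simps)
  have G: "Gamma x > 0" using x by (intro Gamma_real_pos) auto
  have "sqrt (real D / 8) ^ d * Gamma x \<le> sqrt (x / 2) ^ d * Gamma x"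
    using x G by (intro mult_right_mono power_mono) auto
  also have "\<dots> \<le> Gamma (real D / 2 + 1)" using Gamma_add_half_ge[OF x(1), of d] x(3) by simp
  finally have le: "sqrt (real D / 8) ^ d * Gamma x \<le> Gamma (real D / 2 + 1)" .
  have s: "sqrt (real D / 8) ^ d > 0" using assms by simp
  have "pi powr (real D / 2) / pi powr (real (D - d) / 2) = pi powr (real d / 2)"
    using assms by (simp add: of_nat_diff diff_divide_distrib flip: powr_diff)
  also have "\<dots> = sqrt pi ^ d"
    by (simp add: powr_half_sqrt[symmetric] powr_powr flip: powr_realpow)
  finally have pi: "pi powr (real D / 2) / pi powr (real (D - d) / 2) = sqrt pi ^ d" .
  have "unit_ball_vol D / unit_ball_vol (D - d) =
      (pi powr (real D / 2) / pi powr (real (D - d) / 2)) * (Gamma x / Gamma (real D / 2 + 1))"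
    by (simp add: unit_ball_vol_def x_def)
  also have "\<dots> = sqrt pi ^ d * (Gamma x / Gamma (real D / 2 + 1))" by (simp only: pi)
  also have "\<dots> \<le> sqrt pi ^ d * (1 / sqrt (real D / 8) ^ d)"
  proof (rule mult_left_mono)
    have "Gamma (real D / 2 + 1) > 0" by (intro Gamma_real_pos) auto
    then show "Gamma x / Gamma (real D / 2 + 1) \<le> 1 / sqrt (real D / 8) ^ d"
      using le s by (simp add: pos_divide_le_eq pos_le_divide_eq mult.commute)
  qed simp
  also have "\<dots> = sqrt (8 * pi) ^ d / sqrt D ^ d"
    by (simp add: real_sqrt_divide real_sqrt_mult power_divide power_mult_distrib)
  finally show ?thesis .
qed

text \<open>The power of \<open>D\<close> combines the factor \<open>D\<close> lost in the shell
  argument with \<open>D powr (- d / 2)\<close> from the ratio of ball volumes. The bound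
  \<open>s0\<close> makes the remaining factor \<open>sqrt (1 - s\<^sup>2) ^ d\<close>
  uniform.\<close>

lemma inverse_hit_bound_le:
  assumes d: "1 \<le> d" "2 * d \<le> D" and s: "0 < s" "s \<le> s0" "s0 < 1"
  shows "1 / hit_bound D d s \<le>
    exp 1 * sqrt (8 * pi) ^ d / (near_identity_bound d * unit_ball_vol d * sqrt (1 - s0\<^sup>2) ^ d) *
      (real D powr ((2 - real d) / 2) * (1 / s) ^ (D - d))"
proof -
  have D: "0 < real D" using d by simp
  have s2: "s\<^sup>2 \<le> s0\<^sup>2" "s0\<^sup>2 < 1" using s by (auto intro: power_mono simp: abs_square_less_1)
  then have s2': "s\<^sup>2 \<le> 1" by linarith
  have c: "near_identity_bound d > 0" "unit_ball_vol d > 0" using d near_identity_bound_pos by auto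
  let ?c = "exp 1 / (near_identity_bound d * unit_ball_vol d)"
  have "1 / hit_bound D d s = ?c * (unit_ball_vol D / unit_ball_vol (D - d)) * real D *
      (1 / sqrt (1 - s\<^sup>2) ^ d) * (1 / s) ^ (D - d)"
    unfolding hit_bound_def axis_cone_bound_def by (simp add: field_simps exp_minus)
  also have "\<dots> \<le> ?c * (sqrt (8 * pi) ^ d / sqrt D ^ d) * real D * (1 / sqrt (1 - s0\<^sup>2) ^ d) * (1 / s) ^ (D - d)"
  proof (intro mult_mono)
    show "unit_ball_vol D / unit_ball_vol (D - d) \<le> sqrt (8 * pi) ^ d / sqrt D ^ d"
      using d by (intro unit_ball_vol_ratio_le) auto
    show "1 / sqrt (1 - s\<^sup>2) ^ d \<le> 1 / sqrt (1 - s0\<^sup>2) ^ d"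
      using s2 by (intro divide_left_mono power_mono mult_pos_pos zero_less_power) auto
  qed (use c D s s2 s2' in auto)
  finally have le: "1 / hit_bound D d s \<le>
      ?c * (sqrt (8 * pi) ^ d / sqrt D ^ d) * real D * (1 / sqrt (1 - s0\<^sup>2) ^ d) * (1 / s) ^ (D - d)" .
  have "real D / sqrt D ^ d = real D powr ((2 - real d) / 2)"
  proof -
    have "sqrt D ^ d = real D powr (real d / 2)"
      using D by (simp add: powr_half_sqrt[symmetric] powr_powr flip: powr_realpow)
    moreover have "real D powr ((2 - real d) / 2) = real D powr 1 / real D powr (real d / 2)"
    proof -
      have "(2 - real d) / 2 = 1 - real d / 2" by (simp add: diff_divide_distrib)
      then show ?thesis by (simp only: powr_diff)
    qed
    ultimately show ?thesis using D by simp
  qed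
  moreover have "?c * (sqrt (8 * pi) ^ d / sqrt D ^ d) * real D * (1 / sqrt (1 - s0\<^sup>2) ^ d) * (1 / s) ^ (D - d) =
    exp 1 * sqrt (8 * pi) ^ d / (near_identity_bound d * unit_ball_vol d * sqrt (1 - s0\<^sup>2) ^ d) *
      ((real D / sqrt D ^ d) * (1 / s) ^ (D - d))"
    by (simp add: mult_ac)
  ultimately show ?thesis using le by (simp only:)
qed

text \<open>Choosing \<open>g\<close> before the process makes the constant in the O-term uniform
  over all problems and solvers. The threshold is expressed by covering every \<open>k\<close>
  beyond the logarithmic factor times \<open>g\<close>.\<close>

theorem theorem6p6:
  fixes L \<epsilon> lam :: real
    and d_lb :: nat
    and R_max :: "nat \<Rightarrow> real"
  assumes "0 < lam" and "lam < \<epsilon>" and "L > 0" and "1 \<le> d_lb"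
    and "\<And>D. D > d_lb \<Longrightarrow> R_max D > (\<epsilon> - lam) / L"
    and "(\<exists>R. \<forall>D. R_max D = R) \<or> filterlim R_max at_top at_top"
  shows "\<exists>g :: real \<Rightarrow> nat \<Rightarrow> real.
    (\<forall>\<xi>\<in>{0<..<1}. g \<xi> \<in> O(\<lambda>D. real D powr ((2 - real d_lb) / 2)
                                * (L * R_max D / (\<epsilon> - lam)) ^ (D - d_lb))) \<and>
    (\<forall>D > d_lb. \<forall>(M :: 'w measure) X f d A y p xopt xstar \<rho>_lb.
       xrego M D X f lam d A y p xopt \<and>
       (\<forall>x\<in>X. \<forall>z\<in>X. \<bar>f x - f z\<bar> \<le> L * euclid_dist D x z) \<and>
       \<rho>_lb > 0 \<and>
       (\<forall>k\<ge>1. \<exists>\<rho>\<in>{\<rho>_lb..1}. AE \<omega> in M.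
          real_cond_exp M (F_half M D d A y p k)
            (indicat_real (solved M D X f lam d A y p k)) \<omega> \<ge> \<rho>) \<and>
       xstar \<in> X \<and> (\<forall>x\<in>X. f xstar \<le> f x) \<and> euclid_cball D xstar ((\<epsilon> - lam) / L) \<subseteq> X \<and>
       (\<forall>k. \<forall>\<omega>\<in>space M. euclid_dist D (p k \<omega>) xstar \<le> R_max D) \<and>
       (\<forall>k\<ge>1. d k \<ge> d_lb)
       \<longrightarrow>
       (AE \<omega> in M. \<forall>\<^sub>F k in sequentially. xopt k \<omega> \<in> eps_min X f \<epsilon>) \<and>
       (\<lambda>k. measure M {\<omega>\<in>space M. xopt k \<omega> \<in> eps_min X f \<epsilon>}) \<longlonglongrightarrow> 1 \<and>
       (\<forall>\<xi>\<in>{0<..<1}. \<forall>k\<ge>1. real k \<ge> \<bar>ln (1 - \<xi>)\<bar> / \<rho>_lb * g \<xi> D \<longrightarrow>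
          measure M {\<omega>\<in>space M. xopt k \<omega> \<in> eps_min X f \<epsilon>}
            = measure M {\<omega>\<in>space M. f (xopt k \<omega>) \<le> fstar X f + \<epsilon>} \<and>
          measure M {\<omega>\<in>space M. xopt k \<omega> \<in> eps_min X f \<epsilon>} \<ge> \<xi>))"
proof -
  define r where "r = (\<epsilon> - lam) / L"
  have r: "r > 0" using assms by (simp add: r_def)
  have R: "r < R_max D" if "d_lb < D" for D using assms(5) that by (simp add: r_def)
  \<comment> \<open>The reciprocal of the one-step hit bound; \<xi> acts only through the logarithm
    in front of it.\<close>
  define g :: "real \<Rightarrow> nat \<Rightarrow> real" where "g \<xi> D = 1 / hit_bound D d_lb (r / R_max D)" for \<xi> D
  \<comment> \<open>The ratio \<open>r / R_max D\<close> must stay away from 1 uniformly in large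
    \<open>D\<close>: it is constant if the radius bound is, and eventually at most
    \<open>1 / 2\<close> if that bound tends to infinity.\<close>
  obtain s0 where s0: "s0 < 1" "\<forall>\<^sub>F D in sequentially. r / R_max D \<le> s0"
    using assms(6)
  proof
    assume "\<exists>R. \<forall>D. R_max D = R"
    then obtain R0 where R0: "\<And>D. R_max D = R0" by auto
    \<comment> \<open>The lower bound on \<open>R_max\<close> is available only above
      \<open>d_lb\<close>, so it is read off at \<open>Suc d_lb\<close>.\<close>
    then have "r < R0" using R[of "Suc d_lb"] by simp
    with R0 r show ?thesis by (intro that[of "r / R0"]) auto
  next
    assume "filterlim R_max at_top at_top"
    then have "\<forall>\<^sub>F D in sequentially. 2 * r \<le> R_max D"
      unfolding filterlim_at_top by blast
    then have "\<forall>\<^sub>F D in sequentially. r / R_max D \<le> 1 / 2"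
      by eventually_elim (use r in \<open>simp add: field_simps\<close>)
    then show ?thesis by (intro that[of "1 / 2"]) auto
  qed
  let ?h = "\<lambda>D. real D powr ((2 - real d_lb) / 2) * (L * R_max D / (\<epsilon> - lam)) ^ (D - d_lb)"
  let ?c = "exp 1 * sqrt (8 * pi) ^ d_lb / (near_identity_bound d_lb * unit_ball_vol d_lb * sqrt (1 - s0\<^sup>2) ^ d_lb)"
  have O: "g \<xi> \<in> O(?h)" for \<xi>
  proof (rule bigoI[of _ ?c])
    show "\<forall>\<^sub>F D in sequentially. norm (g \<xi> D) \<le> ?c * norm (?h D)"
      using s0(2) eventually_ge_at_top[of "2 * d_lb"]
    proof eventually_elim
      case (elim D)
      have D: "d_lb < D" using elim assms(4) by linarith
      have s: "0 < r / R_max D" "r / R_max D < 1" using r R[OF D] by auto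
      have "hit_bound D d_lb (r / R_max D) > 0" using assms(4) D s by (intro hit_bound_pos)
      then have "norm (g \<xi> D) = 1 / hit_bound D d_lb (r / R_max D)" by (simp add: g_def)
      also have "\<dots> \<le> ?c * (real D powr ((2 - real d_lb) / 2) * (1 / (r / R_max D)) ^ (D - d_lb))"
        using assms(4) elim s(1) s0(1) by (intro inverse_hit_bound_le)
      also have "1 / (r / R_max D) = L * R_max D / (\<epsilon> - lam)" by (simp add: r_def)
      also have "real D powr ((2 - real d_lb) / 2) * (L * R_max D / (\<epsilon> - lam)) ^ (D - d_lb) = norm (?h D)"
      proof -
        have "0 < L * R_max D / (\<epsilon> - lam)" using assms r R[OF D] by (intro divide_pos_pos mult_pos_pos) auto
        then show ?thesis by simp
      qed
      finally show ?case .
    qed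
  qed
  have main: "(AE \<omega> in M. \<forall>\<^sub>F k in sequentially. xopt k \<omega> \<in> eps_min X f \<epsilon>) \<and>
       (\<lambda>k. measure M {\<omega>\<in>space M. xopt k \<omega> \<in> eps_min X f \<epsilon>}) \<longlonglongrightarrow> 1 \<and>
       (\<forall>\<xi>\<in>{0<..<1}. \<forall>k\<ge>1. real k \<ge> \<bar>ln (1 - \<xi>)\<bar> / \<rho>_lb * g \<xi> D \<longrightarrow>
          measure M {\<omega>\<in>space M. xopt k \<omega> \<in> eps_min X f \<epsilon>}
            = measure M {\<omega>\<in>space M. f (xopt k \<omega>) \<le> fstar X f + \<epsilon>} \<and>
          measure M {\<omega>\<in>space M. xopt k \<omega> \<in> eps_min X f \<epsilon>} \<ge> \<xi>)"
    if D: "D > d_lb" and x: "xrego M D X f lam d A y p xopt" and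
       h: "\<forall>x\<in>X. \<forall>z\<in>X. \<bar>f x - f z\<bar> \<le> L * euclid_dist D x z" "\<rho>_lb > 0"
       "\<forall>k\<ge>1. \<exists>\<rho>\<in>{\<rho>_lb..1}. AE \<omega> in M.
          real_cond_exp M (F_half M D d A y p k)
            (indicat_real (solved M D X f lam d A y p k)) \<omega> \<ge> \<rho>"
       "xstar \<in> X" "\<forall>x\<in>X. f xstar \<le> f x" "euclid_cball D xstar ((\<epsilon> - lam) / L) \<subseteq> X"
       "\<forall>k. \<forall>\<omega>\<in>space M. euclid_dist D (p k \<omega>) xstar \<le> R_max D"
       "\<forall>k\<ge>1. d k \<ge> d_lb"
    for D and M :: "'w measure" and X f d A y p xopt xstar \<rho>_lb
  proof -
    interpret xrego_lipschitz M D X f lam d A y p xopt L \<epsilon> "R_max D" \<rho>_lb d_lb xstar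
    proof (intro xrego_lipschitz.intro xrego_lipschitz_axioms.intro x)
      show "lam < \<epsilon>" "L > 0" "1 \<le> d_lb" "d_lb < D" "R_max D > (\<epsilon> - lam) / L" "\<rho>_lb > 0" "xstar \<in> X"
        "euclid_cball D xstar ((\<epsilon> - lam) / L) \<subseteq> X"
        by (fact assms(2-4) D assms(5)[OF D] h(2,4,6))+
      show "\<bar>f x - f z\<bar> \<le> L * euclid_dist D x z" if "x \<in> X" "z \<in> X" for x z
        using h(1) that by blast
      show "f xstar \<le> f x" if "x \<in> X" for x
        using h(5) that by blast
      show "euclid_dist D (p k \<omega>) xstar \<le> R_max D" if "\<omega> \<in> space M" for k \<omega>
        using h(7) that by blast
      show "d_lb \<le> d k" if "k \<ge> 1" for k
        using h(8) that by blast
      show "\<exists>\<rho>\<in>{\<rho>_lb..1}. AE \<omega> in M.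
          real_cond_exp M (F_half M D d A y p k)
            (indicat_real (solved M D X f lam d A y p k)) \<omega> \<ge> \<rho>" if "k \<ge> 1" for k
        by (rule h(3)[rule_format, OF that])
    qed
    have g: "g \<xi> D = 1 / hit_prob" for \<xi>
      by (simp add: g_def hit_prob_def radius_def r_def)
    show ?thesis
      using AE_eps_min prob_eps_min_tendsto eps_min_event(1) prob_eps_min_large
      unfolding g by auto
  qed
  show ?thesis
  proof (rule exI[of _ g], rule conjI)
    show "\<forall>\<xi>\<in>{0<..<1}. g \<xi> \<in> O(?h)" using O by blast
  qed (intro allI impI, elim conjE, rule main; assumption)
qed

end
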